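(* Let $A:\mathbb S\to Set$ be a functor. The functor $\hat A:Set\to Set$ preserves pullbacks if and only if $A$ satisfies both of the following conditions, where in each one considers an arbitrary pullback square of surjections in $\mathbb F$ $$f_1\circ g_2=g_1\circ f_2,\qquad g_2:(p]\to(m],\quad f_2:(p]\to(n],\quad f_1:(m]\to(k],\quad g_1:(n]\to(k].$$ (WPB) For any $a\in A((m])$, $b\in A((n])$ such that $A(f_1)(a)=A(g_1)(b)$, there are an injection $h:(q]\to(p]$ and an element $c\in A((q])$ such that $f_2\circ h$ and $g_2\circ h$ are surjections, $A(g_2\circ h)(c)=a$ and $A(f_2\circ h)(c)=b$. (PB) If $\vec x:(q]\to(p]$ and $\vec x':(q']\to(p]$ are injections and $c\in A((q])$, $c'\in A((q'])$ are elements such that the functions $f_2\circ\vec x$, $f_2\circ\vec x'$, $g_2\circ\vec x$, $g_2\circ\vec x'$ are surjections and $$A(f_2\circ\vec x)(c)=A(f_2\circ\vec x')(c'),\qquad A(g_2\circ\vec x)(c)=A(g_2\circ\vec x')(c'),$$ then $q=q'$ and there is $\sigma\in S_q$ such that $\vec x'\circ\sigma=\vec x$ and $A(\sigma)(c)=c'$.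
   Context: Notation: $(n]=\{1,\dots,n\}$ for $n\in\omega=\{0,1,2,\dots\}$. $\mathbb F$ is the category with objects $(n]$, $n\in\omega$, and all functions as morphisms; $\mathbb S$ is its subcategory with the same objects and surjections. For a set $X$, $\left[{X\atop n}\right]$ is the set of injections $(n]\to X$, on which $S_n$ acts on the right by composition. For $A:\mathbb S\to Set$ write $A_n=A((n])$ and let $\left[{X\atop n}\right]\otimes_n A_n$ be the quotient of $\left[{X\atop n}\right]\times A_n$ by $(\vec x\circ\sigma,a)\sim(\vec x,A(\sigma)(a))$, $\sigma\in S_n$; classes are written $[\vec x,a]$. Put $\hat A(X)=\sum_{n\in\omega}\left[{X\atop n}\right]\otimes_nA_n$. For $f:X\to Y$, $\hat A(f)([\vec x,a])=[\vec y,A(\alpha)(a)]$, where $f\circ\vec x=\vec y\circ\alpha$ with $\alpha:(n]\to(m]$ surjective and $\vec y:(m]\to Y$ injective. (This is the left Kan extension of $A$ along the inclusion $\mathbb S\to Set$.) *)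

theory Defs
  imports Main "HOL-Library.FuncSet"
begin

text \<open>
  A map between sets \<^term>\<open>X\<close> and \<^term>\<open>Y\<close> is an element of the extensional function space
  \<^term>\<open>X \<rightarrow>\<^sub>E Y\<close>, so that equality of maps is equality in HOL; composition of maps is
  \<^const>\<open>compose\<close>, whose first argument is the domain. The set \<open>(n]\<close> is \<open>{1..n}\<close>.
  Since extensional functions do not determine their domain and codomain, these are always given
  explicitly.
\<close>

definition surj_maps :: "nat \<Rightarrow> nat \<Rightarrow> (nat \<Rightarrow> nat) set" where
  "surj_maps n m = {\<alpha> \<in> {1..n} \<rightarrow>\<^sub>E {1..m}. \<alpha> ` {1..n} = {1..m}}"

definition inj_maps :: "nat \<Rightarrow> 'u set \<Rightarrow> (nat \<Rightarrow> 'u) set" where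
  "inj_maps n X = {x \<in> {1..n} \<rightarrow>\<^sub>E X. inj_on x {1..n}}"

definition sym_maps :: "nat \<Rightarrow> (nat \<Rightarrow> nat) set" where
  "sym_maps n = {\<sigma> \<in> {1..n} \<rightarrow>\<^sub>E {1..n}. bij_betw \<sigma> {1..n} {1..n}}"

text \<open>
  Functors from the category of the sets \<open>{1..n}\<close> and surjections to sets. The countably many sets
  \<open>A n\<close> are taken inside one type \<open>'a\<close>, and \<open>Am n m \<alpha>\<close> is the value at \<open>\<alpha> : (n] \<rightarrow> (m]\<close>.
\<close>

locale S_functor =
  fixes A :: "nat \<Rightarrow> 'a set"
    and Am :: "nat \<Rightarrow> nat \<Rightarrow> (nat \<Rightarrow> nat) \<Rightarrow> 'a \<Rightarrow> 'a"
  assumes map_in: "\<alpha> \<in> surj_maps n m \<Longrightarrow> Am n m \<alpha> \<in> A n \<rightarrow>\<^sub>E A m"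
    and map_id: "Am n n (\<lambda>i\<in>{1..n}. i) = (\<lambda>a\<in>A n. a)"
    and map_comp: "\<alpha> \<in> surj_maps n m \<Longrightarrow> \<beta> \<in> surj_maps m k \<Longrightarrow>
      Am n k (compose {1..n} \<beta> \<alpha>) = compose (A n) (Am m k \<beta>) (Am n m \<alpha>)"

text \<open>
  Pullback squares in a full subcategory of sets whose class of objects is \<open>Ob\<close>: the square
  \<open>f \<circ> p = g \<circ> q\<close> is universal with respect to all test objects \<open>T \<in> Ob\<close>. By
  \<open>is_pullback_iff\<close> below, it does not matter from which type the test objects are taken as long as
  a singleton occurs among them.
\<close>

definition is_pullback :: "'t set set \<Rightarrow> 'p set \<Rightarrow> 'x set \<Rightarrow> 'y set \<Rightarrow> 'z set \<Rightarrow>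
    ('p \<Rightarrow> 'x) \<Rightarrow> ('p \<Rightarrow> 'y) \<Rightarrow> ('x \<Rightarrow> 'z) \<Rightarrow> ('y \<Rightarrow> 'z) \<Rightarrow> bool" where
  "is_pullback Ob P X Y Z p q f g \<longleftrightarrow>
     p \<in> P \<rightarrow>\<^sub>E X \<and> q \<in> P \<rightarrow>\<^sub>E Y \<and> f \<in> X \<rightarrow>\<^sub>E Z \<and> g \<in> Y \<rightarrow>\<^sub>E Z \<and>
     compose P f p = compose P g q \<and>
     (\<forall>T\<in>Ob. \<forall>u\<in>T \<rightarrow>\<^sub>E X. \<forall>v\<in>T \<rightarrow>\<^sub>E Y. compose T f u = compose T g v \<longrightarrow>
        (\<exists>!h. h \<in> T \<rightarrow>\<^sub>E P \<and> compose T p h = u \<and> compose T q h = v))"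

lemma is_pullback_iff:
  fixes Ob :: "'t set set"
  assumes t: "{t} \<in> Ob"
  shows "is_pullback Ob P X Y Z p q f g \<longleftrightarrow>
     p \<in> P \<rightarrow>\<^sub>E X \<and> q \<in> P \<rightarrow>\<^sub>E Y \<and> f \<in> X \<rightarrow>\<^sub>E Z \<and> g \<in> Y \<rightarrow>\<^sub>E Z \<and>
     (\<forall>w\<in>P. f (p w) = g (q w)) \<and>
     (\<forall>x\<in>X. \<forall>y\<in>Y. f x = g y \<longrightarrow> (\<exists>!w. w \<in> P \<and> p w = x \<and> q w = y))"
    (is "?L \<longleftrightarrow> ?R")
proof
  assume L: ?L
  have comm: "f (p w) = g (q w)" if "w \<in> P" for w
  proof -
    have "compose P f p w = compose P g q w" using L by (simp add: is_pullback_def)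
    then show ?thesis using that by (simp add: compose_def)
  qed
  have un: "\<exists>!w. w \<in> P \<and> p w = x \<and> q w = y" if x: "x \<in> X" and y: "y \<in> Y" and e: "f x = g y" for x y
  proof -
    let ?u = "\<lambda>s\<in>{t}. x" and ?v = "\<lambda>s\<in>{t}. y"
    have "?u \<in> {t} \<rightarrow>\<^sub>E X" "?v \<in> {t} \<rightarrow>\<^sub>E Y" "compose {t} f ?u = compose {t} g ?v"
      using x y e by (auto simp: compose_def)
    then have ex: "\<exists>!h. h \<in> {t} \<rightarrow>\<^sub>E P \<and> compose {t} p h = ?u \<and> compose {t} q h = ?v"
      using L t unfolding is_pullback_def by blast
    then obtain h where h: "h \<in> {t} \<rightarrow>\<^sub>E P" "compose {t} p h = ?u" "compose {t} q h = ?v" by blast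
    have "p (h t) = x" "q (h t) = y"
      using fun_cong[OF h(2), of t] fun_cong[OF h(3), of t] by (simp_all add: compose_def)
    moreover have "w = h t" if w: "w \<in> P" "p w = x" "q w = y" for w
    proof -
      have "(\<lambda>s\<in>{t}. w) \<in> {t} \<rightarrow>\<^sub>E P" "compose {t} p (\<lambda>s\<in>{t}. w) = ?u"
        "compose {t} q (\<lambda>s\<in>{t}. w) = ?v"
        using w by (auto simp: compose_def)
      then have "(\<lambda>s\<in>{t}. w) = h" using ex h by blast
      then show ?thesis by (metis restrict_apply' singletonI)
    qed
    ultimately show ?thesis using h(1) by (metis PiE_mem singletonI)
  qed
  have "p \<in> P \<rightarrow>\<^sub>E X" "q \<in> P \<rightarrow>\<^sub>E Y" "f \<in> X \<rightarrow>\<^sub>E Z" "g \<in> Y \<rightarrow>\<^sub>E Z"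
    using L by (simp_all add: is_pullback_def)
  then show ?R by (intro conjI ballI impI comm un)
next
  assume R: ?R
  have univ: "\<exists>!h. h \<in> T \<rightarrow>\<^sub>E P \<and> compose T p h = u \<and> compose T q h = v"
    if u: "u \<in> T \<rightarrow>\<^sub>E X" and v: "v \<in> T \<rightarrow>\<^sub>E Y" and e: "compose T f u = compose T g v"
    for T :: "'t set" and u v
  proof -
    let ?W = "\<lambda>s w. w \<in> P \<and> p w = u s \<and> q w = v s"
    have ex: "\<exists>!w. ?W s w" if s: "s \<in> T" for s
    proof -
      have "f (u s) = g (v s)" using fun_cong[OF e, of s] s by (simp add: compose_def)
      then show ?thesis using R PiE_mem[OF u s] PiE_mem[OF v s] by blast
    qed
    let ?h = "\<lambda>s\<in>T. THE w. ?W s w"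
    have W: "?W s (?h s)" if s: "s \<in> T" for s
      using theI'[OF ex[OF s]] s by simp
    show ?thesis
    proof (rule ex1I[of _ ?h], intro conjI)
      show "?h \<in> T \<rightarrow>\<^sub>E P" using W by (auto simp: PiE_def Pi_def)
      show "compose T p ?h = u"
      proof
        fix s show "compose T p ?h s = u s"
          using W[of s] PiE_arb[OF u, of s] by (cases "s \<in> T") (simp_all add: compose_def)
      qed
      show "compose T q ?h = v"
      proof
        fix s show "compose T q ?h s = v s"
          using W[of s] PiE_arb[OF v, of s] by (cases "s \<in> T") (simp_all add: compose_def)
      qed
    next
      fix h assume h: "h \<in> T \<rightarrow>\<^sub>E P \<and> compose T p h = u \<and> compose T q h = v"
      show "h = ?h"
      proof (rule PiE_ext[where s = "\<lambda>_. P"])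
        show "h \<in> T \<rightarrow>\<^sub>E P" using h by blast
        show "?h \<in> T \<rightarrow>\<^sub>E P" using W by (auto simp: PiE_def Pi_def)
        fix s assume s: "s \<in> T"
        have "?W s (h s)" using h s by (auto simp: compose_def)
        then show "h s = ?h s" using ex[OF s] W[OF s] by blast
      qed
    qed
  qed
  have "compose P f p = compose P g q" using R by (auto simp: compose_def)
  moreover have "p \<in> P \<rightarrow>\<^sub>E X" "q \<in> P \<rightarrow>\<^sub>E Y" "f \<in> X \<rightarrow>\<^sub>E Z" "g \<in> Y \<rightarrow>\<^sub>E Z"
    using R by simp_all
  ultimately show ?L unfolding is_pullback_def by (intro conjI ballI impI univ)
qed

definition F_objects :: "nat set set" where
  "F_objects = range (\<lambda>n. {1..n})"

text \<open>Pullback squares \<open>f\<^sub>1 \<circ> g\<^sub>2 = g\<^sub>1 \<circ> f\<^sub>2\<close> of surjections in the category of the sets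
  \<open>{1..n}\<close> and all functions; the apex is \<open>{1..p}\<close>.\<close>

definition surj_pullback :: "nat \<Rightarrow> nat \<Rightarrow> nat \<Rightarrow> nat \<Rightarrow>
    (nat \<Rightarrow> nat) \<Rightarrow> (nat \<Rightarrow> nat) \<Rightarrow> (nat \<Rightarrow> nat) \<Rightarrow> (nat \<Rightarrow> nat) \<Rightarrow> bool" where
  "surj_pullback p m n k g2 f2 f1 g1 \<longleftrightarrow>
     g2 \<in> surj_maps p m \<and> f2 \<in> surj_maps p n \<and> f1 \<in> surj_maps m k \<and> g1 \<in> surj_maps n k \<and>
     is_pullback F_objects {1..p} {1..m} {1..n} {1..k} g2 f2 f1 g1"

text \<open>The relation \<open>(x \<circ> \<sigma>, a) \<sim> (x, A(\<sigma>)(a))\<close>; it is already an equivalence relation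
  (\<open>equiv_tensor_rel\<close> below).\<close>

definition tensor_rel ::
  "(nat \<Rightarrow> 'a set) \<Rightarrow> (nat \<Rightarrow> nat \<Rightarrow> (nat \<Rightarrow> nat) \<Rightarrow> 'a \<Rightarrow> 'a) \<Rightarrow> nat \<Rightarrow> 'u set \<Rightarrow>
    (((nat \<Rightarrow> 'u) \<times> 'a) \<times> ((nat \<Rightarrow> 'u) \<times> 'a)) set" where
  "tensor_rel A Am n X = {((compose {1..n} x \<sigma>, a), (x, Am n n \<sigma> a)) | x \<sigma> a.
     x \<in> inj_maps n X \<and> \<sigma> \<in> sym_maps n \<and> a \<in> A n}"

definition hat_obj ::
  "(nat \<Rightarrow> 'a set) \<Rightarrow> (nat \<Rightarrow> nat \<Rightarrow> (nat \<Rightarrow> nat) \<Rightarrow> 'a \<Rightarrow> 'a) \<Rightarrow> 'u set \<Rightarrow>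
    (nat \<times> ((nat \<Rightarrow> 'u) \<times> 'a) set) set" where
  "hat_obj A Am X = (SIGMA n:UNIV. (inj_maps n X \<times> A n) // tensor_rel A Am n X)"

definition hat_class ::
  "(nat \<Rightarrow> 'a set) \<Rightarrow> (nat \<Rightarrow> nat \<Rightarrow> (nat \<Rightarrow> nat) \<Rightarrow> 'a \<Rightarrow> 'a) \<Rightarrow> 'u set \<Rightarrow> nat \<Rightarrow>
    (nat \<Rightarrow> 'u) \<Rightarrow> 'a \<Rightarrow> nat \<times> ((nat \<Rightarrow> 'u) \<times> 'a) set" where
  "hat_class A Am X n x a = (n, tensor_rel A Am n X `` {(x, a)})"

text \<open>The description below determines the value at \<open>\<xi>\<close> uniquely; see \<open>hat_map_class\<close>.\<close>

definition hat_map ::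
  "(nat \<Rightarrow> 'a set) \<Rightarrow> (nat \<Rightarrow> nat \<Rightarrow> (nat \<Rightarrow> nat) \<Rightarrow> 'a \<Rightarrow> 'a) \<Rightarrow> 'u set \<Rightarrow> 'u set \<Rightarrow> ('u \<Rightarrow> 'u) \<Rightarrow>
    nat \<times> ((nat \<Rightarrow> 'u) \<times> 'a) set \<Rightarrow> nat \<times> ((nat \<Rightarrow> 'u) \<times> 'a) set" where
  "hat_map A Am X Y f = (\<lambda>\<xi>\<in>hat_obj A Am X. THE \<eta>. \<exists>n x a m \<alpha> y.
     x \<in> inj_maps n X \<and> a \<in> A n \<and> \<xi> = hat_class A Am X n x a \<and>
     \<alpha> \<in> surj_maps n m \<and> y \<in> inj_maps m Y \<and>
     compose {1..n} f x = compose {1..n} y \<alpha> \<and>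
     \<eta> = hat_class A Am Y m y (Am n m \<alpha> a))"

text \<open>
  Preservation of pullbacks for a functor given by its object map and its morphism map. The domain
  is the category of all subsets of the type \<open>'u\<close>. If \<open>'u\<close> is infinite, this category is closed
  under pullbacks in all sets and contains a copy of every finite set.
\<close>

definition preserves_pullbacks ::
  "('u set \<Rightarrow> 'b set) \<Rightarrow> ('u set \<Rightarrow> 'u set \<Rightarrow> ('u \<Rightarrow> 'u) \<Rightarrow> 'b \<Rightarrow> 'b) \<Rightarrow> bool" where
  "preserves_pullbacks F Fm \<longleftrightarrow>
     (\<forall>P X Y Z p q f g. is_pullback (UNIV :: 'u set set) P X Y Z p q f g \<longrightarrow>
        is_pullback (UNIV :: 'b set set) (F P) (F X) (F Y) (F Z)
          (Fm P X p) (Fm P Y q) (Fm X Z f) (Fm Y Z g))"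

definition WPB ::
  "(nat \<Rightarrow> 'a set) \<Rightarrow> (nat \<Rightarrow> nat \<Rightarrow> (nat \<Rightarrow> nat) \<Rightarrow> 'a \<Rightarrow> 'a) \<Rightarrow> bool" where
  "WPB A Am \<longleftrightarrow> (\<forall>p m n k g2 f2 f1 g1. surj_pullback p m n k g2 f2 f1 g1 \<longrightarrow>
     (\<forall>a\<in>A m. \<forall>b\<in>A n. Am m k f1 a = Am n k g1 b \<longrightarrow>
        (\<exists>q. \<exists>h\<in>inj_maps q {1..p}. \<exists>c\<in>A q.
           compose {1..q} f2 h \<in> surj_maps q n \<and>
           compose {1..q} g2 h \<in> surj_maps q m \<and>
           Am q m (compose {1..q} g2 h) c = a \<and>
           Am q n (compose {1..q} f2 h) c = b)))"

definition PB ::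
  "(nat \<Rightarrow> 'a set) \<Rightarrow> (nat \<Rightarrow> nat \<Rightarrow> (nat \<Rightarrow> nat) \<Rightarrow> 'a \<Rightarrow> 'a) \<Rightarrow> bool" where
  "PB A Am \<longleftrightarrow> (\<forall>p m n k g2 f2 f1 g1. surj_pullback p m n k g2 f2 f1 g1 \<longrightarrow>
     (\<forall>q q'. \<forall>x\<in>inj_maps q {1..p}. \<forall>x'\<in>inj_maps q' {1..p}. \<forall>c\<in>A q. \<forall>c'\<in>A q'.
        compose {1..q} f2 x \<in> surj_maps q n \<longrightarrow>
        compose {1..q'} f2 x' \<in> surj_maps q' n \<longrightarrow>
        compose {1..q} g2 x \<in> surj_maps q m \<longrightarrow>
        compose {1..q'} g2 x' \<in> surj_maps q' m \<longrightarrow>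
        Am q n (compose {1..q} f2 x) c = Am q' n (compose {1..q'} f2 x') c' \<longrightarrow>
        Am q m (compose {1..q} g2 x) c = Am q' m (compose {1..q'} g2 x') c' \<longrightarrow>
        q = q' \<and> (\<exists>\<sigma>\<in>sym_maps q. compose {1..q} x' \<sigma> = x \<and> Am q q \<sigma> c = c')))"

lemma sym_maps_surj: "\<sigma> \<in> sym_maps n \<Longrightarrow> \<sigma> \<in> surj_maps n n"
  by (auto simp: sym_maps_def surj_maps_def bij_betw_def)

lemma sym_maps_id: "(\<lambda>i\<in>{1..n}. i) \<in> sym_maps n"
  by (auto simp: sym_maps_def bij_betw_def inj_on_def)

lemma sym_maps_compose:
  assumes "\<sigma> \<in> sym_maps n" "\<tau> \<in> sym_maps n"
  shows "compose {1..n} \<sigma> \<tau> \<in> sym_maps n"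
proof -
  have "compose {1..n} \<sigma> \<tau> \<in> {1..n} \<rightarrow>\<^sub>E {1..n}"
    using assms by (auto simp: sym_maps_def compose_def PiE_def Pi_def)
  moreover have "bij_betw (compose {1..n} \<sigma> \<tau>) {1..n} {1..n}"
    using assms bij_betw_compose by (auto simp: sym_maps_def)
  ultimately show ?thesis by (simp add: sym_maps_def)
qed

lemma sym_maps_inverse:
  assumes s: "\<sigma> \<in> sym_maps n"
  obtains \<tau> where "\<tau> \<in> sym_maps n" "compose {1..n} \<sigma> \<tau> = (\<lambda>i\<in>{1..n}. i)"
    "compose {1..n} \<tau> \<sigma> = (\<lambda>i\<in>{1..n}. i)"
proof
  have b: "bij_betw \<sigma> {1..n} {1..n}" using s by (simp add: sym_maps_def)
  let ?t = "restrict (inv_into {1..n} \<sigma>) {1..n}"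
  have bt: "bij_betw ?t {1..n} {1..n}" using bij_betw_inv_into[OF b] by simp
  then show "?t \<in> sym_maps n" by (auto simp: sym_maps_def bij_betw_def)
  show "compose {1..n} \<sigma> ?t = (\<lambda>i\<in>{1..n}. i)"
    using b by (auto simp: compose_def fun_eq_iff bij_betw_inv_into_right)
  have "\<sigma> i \<in> {1..n}" if "i \<in> {1..n}" for i using b that by (metis bij_betwE)
  then show "compose {1..n} ?t \<sigma> = (\<lambda>i\<in>{1..n}. i)"
    unfolding compose_def using b by (auto simp: fun_eq_iff bij_betw_inv_into_left)
qed

lemma inj_maps_compose_sym:
  assumes x: "x \<in> inj_maps n X" and s: "\<sigma> \<in> sym_maps n"
  shows "compose {1..n} x \<sigma> \<in> inj_maps n X"
proof -
  have m: "\<sigma> i \<in> {1..n}" if "i \<in> {1..n}" for i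
    using s that by (auto simp: sym_maps_def PiE_def Pi_def)
  have xi: "inj_on x {1..n}" and si: "inj_on \<sigma> {1..n}"
    using x s by (simp_all add: inj_maps_def sym_maps_def bij_betw_def)
  have "inj_on (compose {1..n} x \<sigma>) {1..n}"
  proof (rule inj_onI)
    fix i j assume ij: "i \<in> {1..n}" "j \<in> {1..n}"
      and "compose {1..n} x \<sigma> i = compose {1..n} x \<sigma> j"
    then have "x (\<sigma> i) = x (\<sigma> j)" by (simp only: compose_eq)
    then have "\<sigma> i = \<sigma> j" using inj_onD[OF xi] m ij by blast
    then show "i = j" using inj_onD[OF si] ij by blast
  qed
  have xp: "x \<in> {1..n} \<rightarrow>\<^sub>E X" using x by (simp add: inj_maps_def)
  have "compose {1..n} x \<sigma> \<in> {1..n} \<rightarrow>\<^sub>E X"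
    unfolding compose_def restrict_PiE_iff using PiE_mem[OF xp m] by blast
  with \<open>inj_on (compose {1..n} x \<sigma>) {1..n}\<close> show ?thesis by (simp add: inj_maps_def)
qed

context S_functor
begin

lemma equiv_tensor_rel: "equiv (inj_maps n X \<times> A n) (tensor_rel A Am n X)"
proof (rule equivI)
  let ?R = "tensor_rel A Am n X"
  have AmA: "Am n n \<sigma> a \<in> A n" if "\<sigma> \<in> sym_maps n" "a \<in> A n" for \<sigma> a
    using map_in[OF sym_maps_surj[OF that(1)]] that(2) by (auto simp: PiE_def Pi_def)
  have AmC: "Am n n (compose {1..n} \<sigma> \<tau>) a = Am n n \<sigma> (Am n n \<tau> a)"
    if "\<sigma> \<in> sym_maps n" "\<tau> \<in> sym_maps n" "a \<in> A n" for \<sigma> \<tau> a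
    using map_comp[OF sym_maps_surj[OF that(2)] sym_maps_surj[OF that(1)]] that(3)
    by (simp add: compose_def)
  have AmI: "Am n n (\<lambda>i\<in>{1..n}. i) a = a" if "a \<in> A n" for a
    using map_id that by simp
  have xI: "compose {1..n} x (\<lambda>i\<in>{1..n}. i) = x" if "x \<in> inj_maps n X" for x
    using that by (auto simp: inj_maps_def compose_def fun_eq_iff PiE_def extensional_def)
  have xC: "compose {1..n} x (compose {1..n} \<sigma> \<tau>) = compose {1..n} (compose {1..n} x \<sigma>) \<tau>"
    if "\<tau> \<in> sym_maps n" for x :: "nat \<Rightarrow> 'c" and \<sigma> \<tau>
    using that by (auto simp: sym_maps_def compose_def fun_eq_iff PiE_def Pi_def)
  show "?R \<subseteq> (inj_maps n X \<times> A n) \<times> (inj_maps n X \<times> A n)"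
    using inj_maps_compose_sym AmA by (auto simp: tensor_rel_def)
  show "refl_on (inj_maps n X \<times> A n) ?R"
  proof (rule refl_onI)
    fix z assume "z \<in> inj_maps n X \<times> A n"
    then obtain x a where z: "z = (x, a)" "x \<in> inj_maps n X" "a \<in> A n" by blast
    have "((compose {1..n} x (\<lambda>i\<in>{1..n}. i), a), (x, Am n n (\<lambda>i\<in>{1..n}. i) a)) \<in> ?R"
      using z sym_maps_id unfolding tensor_rel_def by blast
    then show "(z, z) \<in> ?R" using z AmI xI by simp
  qed
  show "sym ?R"
  proof (rule symI)
    fix z w assume "(z, w) \<in> ?R"
    then obtain x \<sigma> a where d: "z = (compose {1..n} x \<sigma>, a)" "w = (x, Am n n \<sigma> a)"
      "x \<in> inj_maps n X" "\<sigma> \<in> sym_maps n" "a \<in> A n" unfolding tensor_rel_def by blast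
    obtain \<tau> where t: "\<tau> \<in> sym_maps n" "compose {1..n} \<sigma> \<tau> = (\<lambda>i\<in>{1..n}. i)"
      "compose {1..n} \<tau> \<sigma> = (\<lambda>i\<in>{1..n}. i)" using sym_maps_inverse[OF d(4)] .
    have "((compose {1..n} (compose {1..n} x \<sigma>) \<tau>, Am n n \<sigma> a),
           (compose {1..n} x \<sigma>, Am n n \<tau> (Am n n \<sigma> a))) \<in> ?R"
      using d t(1) inj_maps_compose_sym[OF d(3,4)] AmA[OF d(4,5)] unfolding tensor_rel_def by blast
    moreover have "compose {1..n} (compose {1..n} x \<sigma>) \<tau> = x"
      using xC[OF t(1), of x \<sigma>] t(2) xI[OF d(3)] by simp
    moreover have "Am n n \<tau> (Am n n \<sigma> a) = a"
      using AmC[OF t(1) d(4,5)] t(3) AmI[OF d(5)] by simp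
    ultimately show "(w, z) \<in> ?R" using d by simp
  qed
  show "trans ?R"
  proof (rule transI)
    fix z w v assume "(z, w) \<in> ?R" "(w, v) \<in> ?R"
    then obtain x \<sigma> a y \<tau> b where d: "z = (compose {1..n} x \<sigma>, a)" "w = (x, Am n n \<sigma> a)"
      "x \<in> inj_maps n X" "\<sigma> \<in> sym_maps n" "a \<in> A n"
      "w = (compose {1..n} y \<tau>, b)" "v = (y, Am n n \<tau> b)"
      "y \<in> inj_maps n X" "\<tau> \<in> sym_maps n" "b \<in> A n" unfolding tensor_rel_def by blast
    have "((compose {1..n} y (compose {1..n} \<tau> \<sigma>), a), (y, Am n n (compose {1..n} \<tau> \<sigma>) a)) \<in> ?R"
      using d sym_maps_compose unfolding tensor_rel_def by blast
    then show "(z, v) \<in> ?R" using d xC[OF d(4), of y \<tau>] AmC[OF d(9,4,5)] by simp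
  qed
qed

end

lemma factorization_exists:
  assumes w: "w \<in> {1..n} \<rightarrow>\<^sub>E Y"
  shows "\<exists>m. \<exists>\<alpha>\<in>surj_maps n m. \<exists>y\<in>inj_maps m Y. w = compose {1..n} y \<alpha>"
proof -
  obtain e where e: "bij_betw e {1..card (w ` {1..n})} (w ` {1..n})"
    using ex_bij_betw_nat_finite_1[of "w ` {1..n}"] by auto
  let ?m = "card (w ` {1..n})"
  let ?y = "restrict e {1..?m}" and ?a = "\<lambda>i\<in>{1..n}. inv_into {1..?m} e (w i)"
  have im: "w i \<in> e ` {1..?m}" if "i \<in> {1..n}" for i
    using e that by (simp add: bij_betw_def)
  have a_in: "inv_into {1..?m} e (w i) \<in> {1..?m}" if "i \<in> {1..n}" for i
    by (rule inv_into_into[OF im[OF that]])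
  have "(\<lambda>i. inv_into {1..?m} e (w i)) ` {1..n} = inv_into {1..?m} e ` (w ` {1..n})" by auto
  also have "\<dots> = {1..?m}" using bij_betw_inv_into[OF e] by (simp add: bij_betw_def)
  finally have "?a ` {1..n} = {1..?m}" by simp
  then have A: "?a \<in> surj_maps n ?m" using a_in by (simp add: surj_maps_def)
  have "e i \<in> Y" if "i \<in> {1..?m}" for i
  proof -
    have "e i \<in> w ` {1..n}" using bij_betwE[OF e] that by blast
    then show ?thesis using w by (auto simp: PiE_def Pi_def)
  qed
  then have Y: "?y \<in> inj_maps ?m Y" using e by (simp add: inj_maps_def bij_betw_def)
  have "w = compose {1..n} ?y ?a"
  proof
    fix i show "w i = compose {1..n} ?y ?a i"
    proof (cases "i \<in> {1..n}")
      case True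
      have "w i = ?y (?a i)" using a_in[OF True] f_inv_into_f[OF im[OF True]] True by simp
      then show ?thesis using True by (simp add: compose_def)
    next
      case False
      then have "w i = undefined" by (rule PiE_arb[OF w])
      then show ?thesis by (simp only: compose_def restrict_def False if_False)
    qed
  qed
  then show ?thesis using A Y by blast
qed

lemma factorization_unique:
  assumes a: "\<alpha> \<in> surj_maps n m" and y: "y \<in> inj_maps m Y"
    and a': "\<alpha>' \<in> surj_maps n m'" and y': "y' \<in> inj_maps m' Y"
    and e: "compose {1..n} y \<alpha> = compose {1..n} y' \<alpha>'"
  shows "m = m' \<and> (\<exists>\<sigma>\<in>sym_maps m. y = compose {1..m} y' \<sigma> \<and> \<alpha>' = compose {1..n} \<sigma> \<alpha>)"
proof -
  have pt: "y (\<alpha> i) = y' (\<alpha>' i)" if "i \<in> {1..n}" for i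
    using fun_cong[OF e, of i] that by (simp add: compose_def)
  have ran: "y ` {1..m} = y' ` {1..m'}"
  proof -
    have "y ` {1..m} = y ` \<alpha> ` {1..n}" using a by (simp add: surj_maps_def)
    also have "\<dots> = (\<lambda>i. y (\<alpha> i)) ` {1..n}" by (rule image_image)
    also have "\<dots> = (\<lambda>i. y' (\<alpha>' i)) ` {1..n}" using pt by (auto intro!: image_cong)
    also have "\<dots> = y' ` \<alpha>' ` {1..n}" by (rule image_image[symmetric])
    also have "\<dots> = y' ` {1..m'}" using a' by (simp add: surj_maps_def)
    finally show ?thesis .
  qed
  have i: "inj_on y {1..m}" "inj_on y' {1..m'}" using y y' by (simp_all add: inj_maps_def)
  have mm: "m = m'" using card_image[OF i(1)] card_image[OF i(2)] ran by simp
  let ?s = "\<lambda>j\<in>{1..m}. inv_into {1..m} y' (y j)"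
  have b: "bij_betw y {1..m} (y ` {1..m})" "bij_betw y' {1..m} (y ` {1..m})"
    using i ran mm by (simp_all add: bij_betw_def)
  have "bij_betw (inv_into {1..m} y' \<circ> y) {1..m} {1..m}"
    using bij_betw_trans[OF b(1) bij_betw_inv_into[OF b(2)]] .
  then have bs: "bij_betw ?s {1..m} {1..m}" by (simp add: comp_def)
  then have S: "?s \<in> sym_maps m" by (auto simp: sym_maps_def bij_betw_def)
  have ys: "y' (?s j) = y j" if "j \<in> {1..m}" for j
  proof -
    have "y j \<in> y' ` {1..m}" using that ran mm by blast
    then have "y' (inv_into {1..m} y' (y j)) = y j" by (rule f_inv_into_f)
    then show ?thesis using that by simp
  qed
  have sm: "?s j \<in> {1..m}" if "j \<in> {1..m}" for j using bs that by (metis bij_betwE)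
  have "y = compose {1..m} y' ?s"
  proof
    fix j show "y j = compose {1..m} y' ?s j"
    proof (cases "j \<in> {1..m}")
      case True
      then show ?thesis using ys[OF True] by (simp only: compose_def restrict_def if_True)
    next
      case False
      have "y \<in> {1..m} \<rightarrow>\<^sub>E Y" using y by (simp add: inj_maps_def)
      then have "y j = undefined" using False by (rule PiE_arb)
      then show ?thesis by (simp only: compose_def restrict_def False if_False)
    qed
  qed
  moreover have "\<alpha>' = compose {1..n} ?s \<alpha>"
  proof
    fix j show "\<alpha>' j = compose {1..n} ?s \<alpha> j"
    proof (cases "j \<in> {1..n}")
      case True
      have aj: "\<alpha> j \<in> {1..m}" "\<alpha>' j \<in> {1..m}"
        using True a a' mm by (auto simp: surj_maps_def PiE_def Pi_def)
      have "y' (?s (\<alpha> j)) = y' (\<alpha>' j)" using ys[OF aj(1)] pt[OF True] by simp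
      then have "?s (\<alpha> j) = \<alpha>' j"
        using inj_onD[OF i(2)[folded mm]] sm[OF aj(1)] aj(2) by blast
      then show ?thesis using True by (simp add: compose_def)
    next
      case False
      have "\<alpha>' \<in> {1..n} \<rightarrow>\<^sub>E {1..m'}" using a' by (simp add: surj_maps_def)
      then have "\<alpha>' j = undefined" using False by (rule PiE_arb)
      then show ?thesis by (simp only: compose_def restrict_def False if_False)
    qed
  qed
  ultimately show ?thesis using mm S by blast
qed

lemma (in S_functor) hat_map_class:
  assumes f: "f \<in> X \<rightarrow>\<^sub>E Y"
    and x: "x \<in> inj_maps n X" and a: "a \<in> A n"
    and al: "\<alpha> \<in> surj_maps n m" and y: "y \<in> inj_maps m Y"
    and e: "compose {1..n} f x = compose {1..n} y \<alpha>"
  shows "hat_map A Am X Y f (hat_class A Am X n x a) = hat_class A Am Y m y (Am n m \<alpha> a)"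
proof -
  let ?xi = "hat_class A Am X n x a"
  let ?Q = "\<lambda>\<eta> n x a m \<alpha> y. x \<in> inj_maps n X \<and> a \<in> A n \<and> ?xi = hat_class A Am X n x a \<and>
     \<alpha> \<in> surj_maps n m \<and> y \<in> inj_maps m Y \<and>
     compose {1..n} f x = compose {1..n} y \<alpha> \<and> \<eta> = hat_class A Am Y m y (Am n m \<alpha> a)"
  have mem: "?xi \<in> hat_obj A Am X"
    using x a by (auto simp: hat_class_def hat_obj_def intro!: quotientI)
  have "(THE \<eta>. \<exists>n x a m \<alpha> y. ?Q \<eta> n x a m \<alpha> y) = hat_class A Am Y m y (Am n m \<alpha> a)"
  proof (rule the_equality)
    show "\<exists>n' x' a' m' \<alpha>' y'. ?Q (hat_class A Am Y m y (Am n m \<alpha> a)) n' x' a' m' \<alpha>' y'"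
      using x a al y e by blast
  next
    fix \<eta> assume "\<exists>n x a m \<alpha> y. ?Q \<eta> n x a m \<alpha> y"
    then obtain n' x' a' m' \<alpha>' y' where Q: "?Q \<eta> n' x' a' m' \<alpha>' y'" by blast
    then have n': "n' = n" by (simp add: hat_class_def)
    note Q = Q[unfolded n']
    have "tensor_rel A Am n X `` {(x, a)} = tensor_rel A Am n X `` {(x', a')}"
      using Q by (simp add: hat_class_def)
    then have "((x, a), (x', a')) \<in> tensor_rel A Am n X"
      using eq_equiv_class[OF _ equiv_tensor_rel] Q by blast
    then obtain \<sigma> where s: "\<sigma> \<in> sym_maps n" "x = compose {1..n} x' \<sigma>" "a' = Am n n \<sigma> a"
      unfolding tensor_rel_def by blast
    have sn: "\<sigma> i \<in> {1..n}" if "i \<in> {1..n}" for i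
      using s(1) that by (auto simp: sym_maps_def PiE_def Pi_def)
    let ?b = "compose {1..n} \<alpha>' \<sigma>"
    have "\<alpha>' ` (\<sigma> ` {1..n}) = {1..m'}"
      using s(1) Q by (simp add: sym_maps_def bij_betw_def surj_maps_def)
    then have b: "?b \<in> surj_maps n m'"
      by (auto simp: surj_maps_def compose_def image_image)
    have "compose {1..n} y \<alpha> = compose {1..n} y' ?b"
    proof
      fix i
      have "f (x' (\<sigma> i)) = y' (\<alpha>' (\<sigma> i))" if "i \<in> {1..n}"
      proof -
        have "compose {1..n} f x' (\<sigma> i) = compose {1..n} y' \<alpha>' (\<sigma> i)" using Q by simp
        then show ?thesis using sn[OF that] by (simp add: compose_def)
      qed
      then show "compose {1..n} y \<alpha> i = compose {1..n} y' ?b i"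
        unfolding e[symmetric] s(2)
        by (cases "i \<in> {1..n}") (simp_all only: compose_def restrict_def if_True if_False)
    qed
    from factorization_unique[OF al y b _ this] Q obtain \<tau> where t: "m = m'" "\<tau> \<in> sym_maps m"
      "y = compose {1..m} y' \<tau>" "?b = compose {1..n} \<tau> \<alpha>" by blast
    have "Am n m' \<alpha>' a' = Am n m' ?b a"
      using map_comp[OF sym_maps_surj[OF s(1)]] Q s(3) a by (simp add: compose_def)
    also have "\<dots> = Am m m \<tau> (Am n m \<alpha> a)"
      using map_comp[OF al sym_maps_surj[OF t(2)]] t(1,4) a by (simp add: compose_def)
    finally have eq: "Am n m' \<alpha>' a' = Am m m \<tau> (Am n m \<alpha> a)" .
    have "Am n m \<alpha> a \<in> A m" using map_in[OF al] a by (auto simp: PiE_def Pi_def)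
    then have "((y, Am n m \<alpha> a), (y', Am n m' \<alpha>' a')) \<in> tensor_rel A Am m Y"
      unfolding eq unfolding t(3) tensor_rel_def using t(1,2) Q by blast
    then have "tensor_rel A Am m Y `` {(y, Am n m \<alpha> a)} = tensor_rel A Am m Y `` {(y', Am n m' \<alpha>' a')}"
      by (rule equiv_class_eq[OF equiv_tensor_rel])
    then show "\<eta> = hat_class A Am Y m y (Am n m \<alpha> a)"
      using Q t(1) by (simp add: hat_class_def)
  qed
  then show ?thesis unfolding hat_map_def using mem by simp
qed

lemma (in S_functor) hat_map_in:
  assumes f: "f \<in> X \<rightarrow>\<^sub>E Y"
  shows "hat_map A Am X Y f \<in> hat_obj A Am X \<rightarrow>\<^sub>E hat_obj A Am Y"
proof (rule PiE_I)
  fix \<xi> assume "\<xi> \<in> hat_obj A Am X"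
  then obtain n x a where x: "\<xi> = hat_class A Am X n x a" "x \<in> inj_maps n X" "a \<in> A n"
    by (auto simp: hat_obj_def hat_class_def elim!: quotientE)
  have "compose {1..n} f x \<in> {1..n} \<rightarrow>\<^sub>E Y"
    using f x(2) by (auto simp: inj_maps_def compose_def PiE_def Pi_def)
  then obtain m \<alpha> y where y: "\<alpha> \<in> surj_maps n m" "y \<in> inj_maps m Y"
    "compose {1..n} f x = compose {1..n} y \<alpha>" using factorization_exists by blast
  have "Am n m \<alpha> a \<in> A m" using map_in[OF y(1)] x(3) by (auto simp: PiE_def Pi_def)
  then show "hat_map A Am X Y f \<xi> \<in> hat_obj A Am Y"
    unfolding x(1) hat_map_class[OF f x(2,3) y] using y(2)
    by (auto simp: hat_class_def hat_obj_def intro!: quotientI)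
qed (simp add: hat_map_def)

end

theory Submission
  imports Defs
begin

text \<open>
  By \<open>hat_map_class_eq_iff\<close>, \<open>[w, c]\<close> is sent by \<open>f\<close> to \<open>[x, a]\<close> iff \<open>f \<circ> w = x \<circ> \<alpha>\<close> and
  \<open>A(\<alpha>)(c) = a\<close> for some surjection \<open>\<alpha>\<close>. Hence elements of the hat sets over the corners \<open>X\<close>,
  \<open>Y\<close>, \<open>Z\<close> of a pullback square with the same image are carried by injections \<open>x\<close>, \<open>y\<close>, \<open>z\<close> of
  finite sets such that \<open>f \<circ> x\<close> and \<open>g \<circ> y\<close> factor through \<open>z\<close> by surjections. The pullback of
  these surjections embeds into the apex, and every lift of the two elements to the apex factors
  through this embedding. So the existence and the uniqueness of a lift are (WPB) and (PB) for this
  finite square. Conversely, a finite pullback square of surjections is transported into the given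
  infinite type by an injection \<open>e\<close>, and preservation is read off at the classes \<open>[e, a]\<close>.
\<close>

section \<open>Composites of extensional maps and the elementwise form of finite pullback
  squares\<close>

lemma compose_eq_compose_iff:
  "compose S f x = compose S g y \<longleftrightarrow> (\<forall>i\<in>S. f (x i) = g (y i))"
  by (auto simp: compose_def fun_eq_iff)

lemma compose_in_PiE:
  "f \<in> X \<rightarrow>\<^sub>E Y \<Longrightarrow> x \<in> S \<rightarrow>\<^sub>E X \<Longrightarrow> compose S f x \<in> S \<rightarrow>\<^sub>E Y"
  by (auto simp: compose_def)

text \<open>Off \<open>S\<close> the composite is \<open>undefined\<close> by construction, and so
  is \<open>w\<close> because it is extensional; only the points of \<open>S\<close> remain to be
  compared.\<close>

lemma compose_eq_iff:
  assumes w: "w \<in> S \<rightarrow>\<^sub>E Y"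
  shows "compose S f x = w \<longleftrightarrow> (\<forall>i\<in>S. f (x i) = w i)"
proof
  assume R: "\<forall>i\<in>S. f (x i) = w i"
  show "compose S f x = w"
  proof
    fix i show "compose S f x i = w i"
      using R PiE_arb[OF w] by (cases "i \<in> S") (simp_all add: compose_def)
  qed
qed (auto simp: compose_def)

lemma surj_maps_mem: "\<alpha> \<in> surj_maps n m \<Longrightarrow> i \<in> {1..n} \<Longrightarrow> \<alpha> i \<in> {1..m}"
  unfolding surj_maps_def by blast

lemma inj_maps_mem: "x \<in> inj_maps n X \<Longrightarrow> i \<in> {1..n} \<Longrightarrow> x i \<in> X"
  unfolding inj_maps_def by blast

lemma inj_maps_eqD:
  "x \<in> inj_maps n X \<Longrightarrow> x i = x j \<Longrightarrow> i \<in> {1..n} \<Longrightarrow> j \<in> {1..n} \<Longrightarrow> i = j"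
  unfolding inj_maps_def by (auto dest: inj_onD)

lemma inj_maps_compose:
  assumes v: "v \<in> inj_maps r X" and h: "h \<in> inj_maps q {1..r}"
  shows "compose {1..q} v h \<in> inj_maps q X"
proof -
  have "compose {1..q} v h \<in> {1..q} \<rightarrow>\<^sub>E X"
    using compose_in_PiE[of v "{1..r}" X h "{1..q}"] v h by (simp only: inj_maps_def mem_Collect_eq)
  moreover have "inj_on (compose {1..q} v h) {1..q}"
  proof (rule inj_onI)
    fix i j assume ij: "i \<in> {1..q}" "j \<in> {1..q}" "compose {1..q} v h i = compose {1..q} v h j"
    then have "v (h i) = v (h j)" by (simp add: compose_eq)
    then have "h i = h j" using inj_maps_eqD[OF v] inj_maps_mem[OF h] ij by blast
    then show "i = j" using inj_maps_eqD[OF h] ij by blast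
  qed
  ultimately show ?thesis by (simp add: inj_maps_def)
qed

lemma surj_maps_compose:
  assumes a: "\<alpha> \<in> surj_maps n m" and b: "\<beta> \<in> surj_maps m k"
  shows "compose {1..n} \<beta> \<alpha> \<in> surj_maps n k"
proof -
  have "compose {1..n} \<beta> \<alpha> \<in> {1..n} \<rightarrow>\<^sub>E {1..k}"
    using compose_in_PiE[of \<beta> "{1..m}" "{1..k}" \<alpha> "{1..n}"] a b
    by (simp only: surj_maps_def mem_Collect_eq)
  moreover have "compose {1..n} \<beta> \<alpha> ` {1..n} = \<beta> ` \<alpha> ` {1..n}"
    by (auto simp: compose_def)
  ultimately show ?thesis using a b by (simp add: surj_maps_def)
qed

text \<open>The singleton \<open>{1}\<close> occurs among the test objects in
  \<open>F_objects\<close>, so universality can be tested on single points. This turns pullback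
  squares of finite sets into statements about pairs of numbers.\<close>

lemma surj_pullback_iff:
  "surj_pullback p m n k g2 f2 f1 g1 \<longleftrightarrow>
     g2 \<in> surj_maps p m \<and> f2 \<in> surj_maps p n \<and> f1 \<in> surj_maps m k \<and> g1 \<in> surj_maps n k \<and>
     (\<forall>w\<in>{1..p}. f1 (g2 w) = g1 (f2 w)) \<and>
     (\<forall>x\<in>{1..m}. \<forall>y\<in>{1..n}. f1 x = g1 y \<longrightarrow> (\<exists>!w. w \<in> {1..p} \<and> g2 w = x \<and> f2 w = y))"
proof -
  have *: "{1} \<in> F_objects" by (auto simp: F_objects_def intro!: image_eqI[of _ _ 1])
  show ?thesis
    unfolding surj_pullback_def surj_maps_def mem_Collect_eq is_pullback_iff[OF *]
    by (intro iffI; elim conjE; intro conjI; assumption)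
qed

section \<open>Equality of classes and the action of maps on them\<close>

context S_functor
begin

lemma Am_mem: "\<alpha> \<in> surj_maps n m \<Longrightarrow> a \<in> A n \<Longrightarrow> Am n m \<alpha> a \<in> A m"
  using map_in by blast

lemma Am_compose:
  "\<alpha> \<in> surj_maps n m \<Longrightarrow> \<beta> \<in> surj_maps m k \<Longrightarrow> a \<in> A n \<Longrightarrow>
    Am n k (compose {1..n} \<beta> \<alpha>) a = Am m k \<beta> (Am n m \<alpha> a)"
  by (simp only: map_comp compose_eq)

lemma hat_obj_cases:
  assumes "\<xi> \<in> hat_obj A Am X"
  obtains n x a where "x \<in> inj_maps n X" "a \<in> A n" "\<xi> = hat_class A Am X n x a"
  using assms by (auto simp: hat_obj_def hat_class_def elim!: quotientE)

lemma hat_class_mem: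
  "x \<in> inj_maps n X \<Longrightarrow> a \<in> A n \<Longrightarrow> hat_class A Am X n x a \<in> hat_obj A Am X"
  by (auto simp: hat_class_def hat_obj_def intro!: quotientI)

text \<open>\<open>tensor_rel\<close> is an equivalence relation without taking any closure, so two
  equal classes are linked by one permutation rather than by a chain of them.\<close>

lemma hat_class_eq_iff:
  assumes x: "x \<in> inj_maps n X" and a: "a \<in> A n"
    and y: "y \<in> inj_maps m X" and b: "b \<in> A m"
  shows "hat_class A Am X n x a = hat_class A Am X m y b \<longleftrightarrow>
    n = m \<and> (\<exists>\<sigma>\<in>sym_maps n. x = compose {1..n} y \<sigma> \<and> Am n n \<sigma> a = b)"
proof -
  have "tensor_rel A Am n X `` {(x, a)} = tensor_rel A Am n X `` {(y, b)} \<longleftrightarrow>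
      (\<exists>\<sigma>\<in>sym_maps n. x = compose {1..n} y \<sigma> \<and> Am n n \<sigma> a = b)" if "n = m"
  proof -
    have "tensor_rel A Am n X `` {(x, a)} = tensor_rel A Am n X `` {(y, b)} \<longleftrightarrow>
        ((x, a), (y, b)) \<in> tensor_rel A Am n X"
      using eq_equiv_class_iff[OF equiv_tensor_rel] assms that by blast
    also have "\<dots> \<longleftrightarrow> (\<exists>\<sigma>\<in>sym_maps n. x = compose {1..n} y \<sigma> \<and> Am n n \<sigma> a = b)"
      using assms that by (auto simp: tensor_rel_def)
    finally show ?thesis .
  qed
  then show ?thesis by (auto simp: hat_class_def)
qed

text \<open>Any factorization of \<open>f \<circ> w\<close> into a surjection \<beta> and an
  injection \<open>y\<close> computes the value. If the resulting class is that of
  \<open>(x, a)\<close>, then \<open>y = x \<circ> \<sigma>\<close> for a permutation \<sigma>, and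
  \<sigma> can be absorbed into the surjection, giving
  \<open>\<alpha> = \<sigma> \<circ> \<beta>\<close>.\<close>

lemma hat_map_class_eq_iff:
  assumes f: "f \<in> X \<rightarrow>\<^sub>E Y"
    and w: "w \<in> inj_maps n X" and c: "c \<in> A n"
    and x: "x \<in> inj_maps m Y" and a: "a \<in> A m"
  shows "hat_map A Am X Y f (hat_class A Am X n w c) = hat_class A Am Y m x a \<longleftrightarrow>
    (\<exists>\<alpha>\<in>surj_maps n m. compose {1..n} f w = compose {1..n} x \<alpha> \<and> Am n m \<alpha> c = a)"
    (is "?L \<longleftrightarrow> ?R")
proof
  assume ?R
  then show ?L using hat_map_class[OF f w c _ x] by blast
next
  assume L: ?L
  have "compose {1..n} f w \<in> {1..n} \<rightarrow>\<^sub>E Y"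
    using f w by (intro compose_in_PiE) (auto simp: inj_maps_def)
  then obtain l \<beta> y where y: "\<beta> \<in> surj_maps n l" "y \<in> inj_maps l Y"
    "compose {1..n} f w = compose {1..n} y \<beta>" using factorization_exists by blast
  have "hat_class A Am Y l y (Am n l \<beta> c) = hat_class A Am Y m x a"
    using hat_map_class[OF f w c y] L by simp
  then obtain \<sigma> where s: "l = m" "\<sigma> \<in> sym_maps m" "y = compose {1..m} x \<sigma>"
    "Am m m \<sigma> (Am n m \<beta> c) = a"
    using hat_class_eq_iff[OF y(2) Am_mem[OF y(1) c] x a] by blast
  note y = y[unfolded s(1)]
  let ?\<alpha> = "compose {1..n} \<sigma> \<beta>"
  have "?\<alpha> \<in> surj_maps n m" using surj_maps_compose[OF y(1) sym_maps_surj[OF s(2)]] .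
  moreover have "Am n m ?\<alpha> c = a"
    using Am_compose[OF y(1) sym_maps_surj[OF s(2)] c] s(4) by simp
  moreover have "compose {1..n} f w = compose {1..n} x ?\<alpha>"
    unfolding y(3) compose_eq_compose_iff s(3) using surj_maps_mem[OF y(1)]
    by (simp add: compose_eq)
  ultimately show ?R by blast
qed

text \<open>Going around the square in either direction amounts to factoring the same map
  \<open>f \<circ> p \<circ> w = g \<circ> q \<circ> w\<close> into a surjection and an injection,
  in two stages each time. The two factorizations differ by a permutation, which identifies the
  resulting classes.\<close>

lemma hat_map_comm:
  assumes p: "p \<in> P \<rightarrow>\<^sub>E X" and q: "q \<in> P \<rightarrow>\<^sub>E Y"
    and f: "f \<in> X \<rightarrow>\<^sub>E Z" and g: "g \<in> Y \<rightarrow>\<^sub>E Z"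
    and comm: "\<forall>w\<in>P. f (p w) = g (q w)" and \<xi>: "\<xi> \<in> hat_obj A Am P"
  shows "hat_map A Am X Z f (hat_map A Am P X p \<xi>) = hat_map A Am Y Z g (hat_map A Am P Y q \<xi>)"
proof -
  obtain r w c where w: "w \<in> inj_maps r P" "c \<in> A r" "\<xi> = hat_class A Am P r w c"
    using hat_obj_cases[OF \<xi>] .
  have "hat_map A Am P X p \<xi> \<in> hat_obj A Am X" "hat_map A Am P Y q \<xi> \<in> hat_obj A Am Y"
    using hat_map_in[OF p] hat_map_in[OF q] \<xi> by blast+
  then obtain m x a n y b where x: "x \<in> inj_maps m X" "a \<in> A m"
    "hat_map A Am P X p \<xi> = hat_class A Am X m x a"
    and y: "y \<in> inj_maps n Y" "b \<in> A n" "hat_map A Am P Y q \<xi> = hat_class A Am Y n y b"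
    by (metis hat_obj_cases)
  obtain \<alpha> where \<alpha>: "\<alpha> \<in> surj_maps r m" "compose {1..r} p w = compose {1..r} x \<alpha>" "Am r m \<alpha> c = a"
    using hat_map_class_eq_iff[OF p w(1,2) x(1,2)] x(3) w(3) by blast
  obtain \<beta> where \<beta>: "\<beta> \<in> surj_maps r n" "compose {1..r} q w = compose {1..r} y \<beta>" "Am r n \<beta> c = b"
    using hat_map_class_eq_iff[OF q w(1,2) y(1,2)] y(3) w(3) by blast
  have "hat_map A Am X Z f (hat_map A Am P X p \<xi>) \<in> hat_obj A Am Z"
    using hat_map_in[OF f] hat_map_in[OF p] \<xi> by blast
  then obtain k z d where z: "z \<in> inj_maps k Z" "d \<in> A k"
    "hat_map A Am X Z f (hat_class A Am X m x a) = hat_class A Am Z k z d"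
    unfolding x(3) by (metis hat_obj_cases)
  obtain f1 where f1: "f1 \<in> surj_maps m k" "compose {1..m} f x = compose {1..m} z f1"
    "Am m k f1 a = d"
    using hat_map_class_eq_iff[OF f x(1,2) z(1,2)] z(3) by blast
  have zz: "f (x i) = z (f1 i)" if "i \<in> {1..m}" for i
    using f1(2) that unfolding compose_eq_compose_iff by blast
  have gz: "\<forall>i\<in>{1..r}. g (y (\<beta> i)) = z (f1 (\<alpha> i))"
  proof
    fix i assume i: "i \<in> {1..r}"
    have "g (y (\<beta> i)) = g (q (w i))" using \<beta>(2) i unfolding compose_eq_compose_iff by simp
    also have "\<dots> = f (p (w i))" using comm inj_maps_mem[OF w(1) i] by simp
    also have "\<dots> = f (x (\<alpha> i))" using \<alpha>(2) i unfolding compose_eq_compose_iff by simp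
    finally show "g (y (\<beta> i)) = z (f1 (\<alpha> i))" using zz surj_maps_mem[OF \<alpha>(1) i] by simp
  qed
  have "compose {1..n} g y \<in> {1..n} \<rightarrow>\<^sub>E Z"
    using g y by (intro compose_in_PiE) (auto simp: inj_maps_def)
  then obtain l \<gamma> u where u: "\<gamma> \<in> surj_maps n l" "u \<in> inj_maps l Z"
    "compose {1..n} g y = compose {1..n} u \<gamma>" using factorization_exists by blast
  have gy: "g (y i) = u (\<gamma> i)" if "i \<in> {1..n}" for i
    using u(3) that unfolding compose_eq_compose_iff by blast
  have A: "compose {1..r} f1 \<alpha> \<in> surj_maps r k" "compose {1..r} \<gamma> \<beta> \<in> surj_maps r l"
    using surj_maps_compose \<alpha>(1) \<beta>(1) f1(1) u(1) by blast+
  \<comment> \<open>The left side factors \<open>f \<circ> p \<circ> w\<close> and the right side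
    \<open>g \<circ> q \<circ> w\<close>; both surjective parts are composites of surjections, so
    uniqueness of the factorization applies.\<close>
  have "compose {1..r} z (compose {1..r} f1 \<alpha>) = compose {1..r} u (compose {1..r} \<gamma> \<beta>)"
    unfolding compose_eq_compose_iff using gz gy surj_maps_mem[OF \<beta>(1)]
    by (simp add: compose_eq)
  from factorization_unique[OF A(1) z(1) A(2) u(2) this] obtain \<sigma> where
    s: "l = k" "\<sigma> \<in> sym_maps k" "z = compose {1..k} u \<sigma>"
    "compose {1..r} \<gamma> \<beta> = compose {1..r} \<sigma> (compose {1..r} f1 \<alpha>)" by blast
  note u = u[unfolded s(1)]
  have "Am n k \<gamma> b = Am r k (compose {1..r} \<gamma> \<beta>) c" using Am_compose[OF \<beta>(1) u(1) w(2)] \<beta>(3) by simp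
  also have "\<dots> = Am k k \<sigma> (Am m k f1 a)"
    unfolding s(4) using Am_compose[OF A(1) sym_maps_surj[OF s(2)] w(2)]
      Am_compose[OF \<alpha>(1) f1(1) w(2)] \<alpha>(3) by simp
  finally have "hat_class A Am Z k z d = hat_class A Am Z k u (Am n k \<gamma> b)"
    using hat_class_eq_iff[OF z(1,2) u(2) Am_mem[OF u(1) y(2)]] s(2,3) f1(3) by auto
  then show ?thesis
    unfolding x(3) y(3) z(3) using hat_map_class[OF g y(1,2) u] by simp
qed

end

section \<open>The finite pullback inside a pullback square of arbitrary sets\<close>

text \<open>The points of \<open>P\<close> lying over the images of \<open>x\<close> and
  \<open>y\<close> are finitely many. Enumerating them by \<open>v\<close> and reading their
  projections as indices yields \<open>g2\<close> and \<open>f2\<close>. Injectivity of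
  \<open>z\<close> makes \<open>f (x j) = g (y l)\<close> equivalent to \<open>f1 j = g1 l\<close>,
  so the universal property of \<open>P\<close> restricts to the finite square. The last conclusion
  repeats the existence half of that property in the form in which lifts are factored through
  \<open>v\<close>.\<close>

lemma finite_pullback_exists:
  assumes fg: "f \<in> X \<rightarrow>\<^sub>E Z" "g \<in> Y \<rightarrow>\<^sub>E Z"
    and univ: "\<forall>x\<in>X. \<forall>y\<in>Y. f x = g y \<longrightarrow> (\<exists>!w. w \<in> P \<and> p w = x \<and> q w = y)"
    and comm: "\<forall>w\<in>P. f (p w) = g (q w)"
    and x: "x \<in> inj_maps m X" and y: "y \<in> inj_maps n Y" and z: "z \<in> inj_maps k Z"
    and f1: "f1 \<in> surj_maps m k" "compose {1..m} f x = compose {1..m} z f1"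
    and g1: "g1 \<in> surj_maps n k" "compose {1..n} g y = compose {1..n} z g1"
  obtains r v g2 f2 where "surj_pullback r m n k g2 f2 f1 g1" "v \<in> inj_maps r P"
    "\<forall>i\<in>{1..r}. p (v i) = x (g2 i)" "\<forall>i\<in>{1..r}. q (v i) = y (f2 i)"
    "\<And>j l. j \<in> {1..m} \<Longrightarrow> l \<in> {1..n} \<Longrightarrow> f1 j = g1 l \<Longrightarrow> \<exists>i\<in>{1..r}. g2 i = j \<and> f2 i = l"
proof -
  let ?R = "{w \<in> P. p w \<in> x ` {1..m} \<and> q w \<in> y ` {1..n}}"
  have fx: "f (x i) = z (f1 i)" if "i \<in> {1..m}" for i
    using f1(2) that unfolding compose_eq_compose_iff by blast
  have gy: "g (y i) = z (g1 i)" if "i \<in> {1..n}" for i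
    using g1(2) that unfolding compose_eq_compose_iff by blast
  have XY: "x i \<in> X" "y j \<in> Y" if "i \<in> {1..m}" "j \<in> {1..n}" for i j
    using inj_maps_mem x y that by blast+
  have uniq: "w = w'" if "w \<in> ?R" "w' \<in> ?R" "p w = p w'" "q w = q w'" for w w'
  proof -
    have P: "w \<in> P" "w' \<in> P" using that(1,2) by blast+
    have "x ` {1..m} \<subseteq> X" "y ` {1..n} \<subseteq> Y" using inj_maps_mem[OF x] inj_maps_mem[OF y] by blast+
    then have "p w \<in> X" "q w \<in> Y" "f (p w) = g (q w)" using that(1) comm by blast+
    then have "\<exists>!u. u \<in> P \<and> p u = p w \<and> q u = q w" using univ by blast
    then show ?thesis using P that(3,4) by metis
  qed
  \<comment> \<open>A point of \<open>P\<close> is determined by its two projections, so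
    \<open>?R\<close> embeds into a product of two finite images.\<close>
  have "inj_on (\<lambda>w. (p w, q w)) ?R"
    by (intro inj_onI uniq) (simp_all only: prod.inject)
  moreover have "(\<lambda>w. (p w, q w)) ` ?R \<subseteq> x ` {1..m} \<times> y ` {1..n}" by auto
  ultimately have "finite ?R" by (meson finite_SigmaI finite_atLeastAtMost finite_imageI inj_on_finite)
  then obtain e where e: "bij_betw e {1..card ?R} ?R" using ex_bij_betw_nat_finite_1 by blast
  define r where "r = card ?R"
  define v where "v = restrict e {1..r}"
  \<comment> \<open>Since \<open>x\<close> and \<open>y\<close> are injective,
    \<open>inv_into\<close> recovers the unique index of each projection of
    \<open>v i\<close>.\<close>
  define g2 where "g2 = (\<lambda>i\<in>{1..r}. inv_into {1..m} x (p (v i)))"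
  define f2 where "f2 = (\<lambda>i\<in>{1..r}. inv_into {1..n} y (q (v i)))"
  have vb: "bij_betw v {1..r} ?R" using e by (simp add: v_def r_def)
  have vR: "v i \<in> ?R" if "i \<in> {1..r}" for i using bij_betwE[OF vb] that by blast
  have v: "v \<in> inj_maps r P" using vR vb by (auto simp: inj_maps_def v_def bij_betw_def)
  have g2: "g2 i \<in> {1..m}" "p (v i) = x (g2 i)" if "i \<in> {1..r}" for i
  proof -
    have "p (v i) \<in> x ` {1..m}" using vR[OF that] by blast
    then show "g2 i \<in> {1..m}" "p (v i) = x (g2 i)"
      unfolding g2_def using that by (simp_all only: restrict_apply' inv_into_into f_inv_into_f)
  qed
  have f2: "f2 i \<in> {1..n}" "q (v i) = y (f2 i)" if "i \<in> {1..r}" for i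
  proof -
    have "q (v i) \<in> y ` {1..n}" using vR[OF that] by blast
    then show "f2 i \<in> {1..n}" "q (v i) = y (f2 i)"
      unfolding f2_def using that by (simp_all only: restrict_apply' inv_into_into f_inv_into_f)
  qed
  have ex: "\<exists>i\<in>{1..r}. g2 i = j \<and> f2 i = l" if jl: "j \<in> {1..m}" "l \<in> {1..n}" "f1 j = g1 l" for j l
  proof -
    have "f (x j) = g (y l)" using fx gy jl by simp
    then obtain w where w: "w \<in> P" "p w = x j" "q w = y l" using univ XY jl by blast
    have "w \<in> ?R" unfolding mem_Collect_eq w(2,3) using w(1) jl(1,2) by (intro conjI imageI)
    then have "w \<in> v ` {1..r}" using vb by (simp only: bij_betw_def)
    then obtain i where i: "i \<in> {1..r}" "v i = w" by (metis imageE)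
    have "x (g2 i) = x j" "y (f2 i) = y l" using g2 f2 i w by metis+
    then have "g2 i = j" "f2 i = l"
      using inj_maps_eqD[OF x] inj_maps_eqD[OF y] g2(1)[OF i(1)] f2(1)[OF i(1)] jl by blast+
    with i show ?thesis by blast
  qed
  have comm': "f1 (g2 i) = g1 (f2 i)" if "i \<in> {1..r}" for i
  proof -
    have "z (f1 (g2 i)) = f (p (v i))" using g2[OF that] fx by simp
    also have "\<dots> = g (q (v i))" using comm vR[OF that] by blast
    also have "\<dots> = z (g1 (f2 i))" using f2[OF that] gy by simp
    finally show ?thesis
      using inj_maps_eqD[OF z] surj_maps_mem[OF f1(1)] surj_maps_mem[OF g1(1)] g2(1) f2(1) that
      by blast
  qed
  have uniq': "i = i'" if "i \<in> {1..r}" "i' \<in> {1..r}" "g2 i = g2 i'" "f2 i = f2 i'" for i i'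
    using uniq[OF vR vR] g2(2) f2(2) inj_maps_eqD[OF v] that by metis
  \<comment> \<open>Surjections are stable under pullback: \<open>g1\<close> hits
    \<open>f1 j\<close> at some \<open>l\<close>, and the pair \<open>(j, l)\<close> comes from a
    point over \<open>j\<close>. The argument for \<open>f2\<close> below is symmetric.\<close>
  have "g2 ` {1..r} = {1..m}"
  proof
    show "g2 ` {1..r} \<subseteq> {1..m}" using g2 by blast
    show "{1..m} \<subseteq> g2 ` {1..r}"
    proof
      fix j assume j: "j \<in> {1..m}"
      then have "f1 j \<in> g1 ` {1..n}" using surj_maps_mem[OF f1(1) j] g1(1) by (simp add: surj_maps_def)
      then obtain l where "l \<in> {1..n}" "f1 j = g1 l" by blast
      then show "j \<in> g2 ` {1..r}" using ex[OF j] by blast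
    qed
  qed
  then have G: "g2 \<in> surj_maps r m" using g2(1) by (auto simp: surj_maps_def g2_def)
  have "f2 ` {1..r} = {1..n}"
  proof
    show "f2 ` {1..r} \<subseteq> {1..n}" using f2 by blast
    show "{1..n} \<subseteq> f2 ` {1..r}"
    proof
      fix l assume l: "l \<in> {1..n}"
      then have "g1 l \<in> f1 ` {1..m}" using surj_maps_mem[OF g1(1) l] f1(1) by (simp add: surj_maps_def)
      then obtain j where "j \<in> {1..m}" "f1 j = g1 l" by (metis imageE)
      then show "l \<in> f2 ` {1..r}" using ex[OF _ l] by blast
    qed
  qed
  then have F: "f2 \<in> surj_maps r n" using f2(1) by (auto simp: surj_maps_def f2_def)
  have ex1: "\<exists>!i. i \<in> {1..r} \<and> g2 i = j \<and> f2 i = l"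
    if jl: "j \<in> {1..m}" "l \<in> {1..n}" "f1 j = g1 l" for j l
  proof -
    obtain i where i: "i \<in> {1..r}" "g2 i = j" "f2 i = l" using ex[OF jl] by blast
    show ?thesis
    proof (rule ex1I[of _ i])
      fix i' assume "i' \<in> {1..r} \<and> g2 i' = j \<and> f2 i' = l"
      then show "i' = i" using uniq'[of i' i] i by metis
    qed (intro conjI i)
  qed
  have "surj_pullback r m n k g2 f2 f1 g1"
    unfolding surj_pullback_iff by (intro conjI ballI impI G F f1(1) g1(1) comm' ex1)
  then show ?thesis by (rule that) (use v g2(2) f2(2) ex in \<open>(rule ballI)?, assumption | blast\<close>)+
qed

section \<open>Sufficiency of (WPB) and (PB)\<close>

context S_functor
begin

text \<open>(WPB) for the finite pullback supplies an injection \<open>h\<close> into its apex and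
  an element \<open>c\<close>. Composing \<open>h\<close> with the embedding \<open>v\<close> gives
  the lift \<open>[v \<circ> h, c]\<close>, because \<open>p \<circ> v = x \<circ> g2\<close> and
  \<open>q \<circ> v = y \<circ> f2\<close>.\<close>

lemma hat_lift_exists:
  assumes W: "WPB A Am"
    and p: "p \<in> P \<rightarrow>\<^sub>E X" and q: "q \<in> P \<rightarrow>\<^sub>E Y"
    and f: "f \<in> X \<rightarrow>\<^sub>E Z" and g: "g \<in> Y \<rightarrow>\<^sub>E Z"
    and comm: "\<forall>w\<in>P. f (p w) = g (q w)"
    and univ: "\<forall>x\<in>X. \<forall>y\<in>Y. f x = g y \<longrightarrow> (\<exists>!w. w \<in> P \<and> p w = x \<and> q w = y)"
    and \<xi>: "\<xi> \<in> hat_obj A Am X" and \<eta>: "\<eta> \<in> hat_obj A Am Y"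
    and eq: "hat_map A Am X Z f \<xi> = hat_map A Am Y Z g \<eta>"
  shows "\<exists>\<omega>\<in>hat_obj A Am P. hat_map A Am P X p \<omega> = \<xi> \<and> hat_map A Am P Y q \<omega> = \<eta>"
proof -
  obtain m x a where x: "x \<in> inj_maps m X" "a \<in> A m" "\<xi> = hat_class A Am X m x a"
    using hat_obj_cases[OF \<xi>] .
  obtain n y b where y: "y \<in> inj_maps n Y" "b \<in> A n" "\<eta> = hat_class A Am Y n y b"
    using hat_obj_cases[OF \<eta>] .
  have "hat_map A Am X Z f \<xi> \<in> hat_obj A Am Z" using hat_map_in[OF f] \<xi> by blast
  then obtain k z d where z: "z \<in> inj_maps k Z" "d \<in> A k"
    "hat_map A Am X Z f \<xi> = hat_class A Am Z k z d" using hat_obj_cases by metis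
  obtain f1 where f1: "f1 \<in> surj_maps m k" "compose {1..m} f x = compose {1..m} z f1"
    "Am m k f1 a = d"
    using hat_map_class_eq_iff[OF f x(1,2) z(1,2)] z(3) x(3) by blast
  \<comment> \<open>The two images agree, so the representative \<open>(z, d)\<close> chosen for the
    image of \<xi> also serves for that of \<eta>. Hence \<open>A(f1)(a) = d = A(g1)(b)\<close>, as
    (WPB) demands.\<close>
  obtain g1 where g1: "g1 \<in> surj_maps n k" "compose {1..n} g y = compose {1..n} z g1"
    "Am n k g1 b = d"
    using hat_map_class_eq_iff[OF g y(1,2) z(1,2)] z(3) y(3) eq by metis
  obtain r v g2 f2 where R: "surj_pullback r m n k g2 f2 f1 g1" "v \<in> inj_maps r P"
    "\<forall>i\<in>{1..r}. p (v i) = x (g2 i)" "\<forall>i\<in>{1..r}. q (v i) = y (f2 i)"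
    using finite_pullback_exists[OF f g univ comm x(1) y(1) z(1) f1(1,2) g1(1,2)] by metis
  from W R(1) x(2) y(2) f1(3) g1(3) obtain s h c where h: "h \<in> inj_maps s {1..r}" "c \<in> A s"
    "compose {1..s} f2 h \<in> surj_maps s n" "compose {1..s} g2 h \<in> surj_maps s m"
    "Am s m (compose {1..s} g2 h) c = a" "Am s n (compose {1..s} f2 h) c = b"
    unfolding WPB_def by metis
  let ?w = "compose {1..s} v h"
  have w: "?w \<in> inj_maps s P" using inj_maps_compose[OF R(2) h(1)] .
  have "compose {1..s} p ?w = compose {1..s} x (compose {1..s} g2 h)"
    "compose {1..s} q ?w = compose {1..s} y (compose {1..s} f2 h)"
    unfolding compose_eq_compose_iff using R(3,4) inj_maps_mem[OF h(1)] by (simp_all add: compose_eq)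
  then have "hat_map A Am P X p (hat_class A Am P s ?w c) = \<xi>"
    "hat_map A Am P Y q (hat_class A Am P s ?w c) = \<eta>"
    using hat_map_class_eq_iff[OF p w h(2) x(1,2)] hat_map_class_eq_iff[OF q w h(2) y(1,2)]
      h(3-6) x(3) y(3) by blast+
  then show ?thesis using hat_class_mem[OF w h(2)] by blast
qed

text \<open>Both lifts factor through the embedding \<open>v\<close> of the finite pullback, as
  \<open>w = v \<circ> h\<close> and \<open>w' = v \<circ> h'\<close>. (PB) applied to
  \<open>h\<close> and \<open>h'\<close> then yields a permutation identifying the two
  classes.\<close>

lemma hat_lift_unique:
  fixes P X Y Z :: "'u set"
  assumes PB: "PB A Am"
    and p: "p \<in> P \<rightarrow>\<^sub>E X" and q: "q \<in> P \<rightarrow>\<^sub>E Y"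
    and f: "f \<in> X \<rightarrow>\<^sub>E Z" and g: "g \<in> Y \<rightarrow>\<^sub>E Z"
    and comm: "\<forall>w\<in>P. f (p w) = g (q w)"
    and univ: "\<forall>x\<in>X. \<forall>y\<in>Y. f x = g y \<longrightarrow> (\<exists>!w. w \<in> P \<and> p w = x \<and> q w = y)"
    and \<omega>: "\<omega> \<in> hat_obj A Am P" and \<omega>': "\<omega>' \<in> hat_obj A Am P"
    and eqX: "hat_map A Am P X p \<omega> = hat_map A Am P X p \<omega>'"
    and eqY: "hat_map A Am P Y q \<omega> = hat_map A Am P Y q \<omega>'"
  shows "\<omega> = \<omega>'"
proof -
  obtain s w c where w: "w \<in> inj_maps s P" "c \<in> A s" "\<omega> = hat_class A Am P s w c"
    using hat_obj_cases[OF \<omega>] .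
  obtain s' w' c' where w': "w' \<in> inj_maps s' P" "c' \<in> A s'" "\<omega>' = hat_class A Am P s' w' c'"
    using hat_obj_cases[OF \<omega>'] .
  have \<xi>: "hat_map A Am P X p \<omega> \<in> hat_obj A Am X" using hat_map_in[OF p] \<omega> by blast
  have \<eta>: "hat_map A Am P Y q \<omega> \<in> hat_obj A Am Y" using hat_map_in[OF q] \<omega> by blast
  obtain m x a where x: "x \<in> inj_maps m X" "a \<in> A m"
    "hat_map A Am P X p \<omega> = hat_class A Am X m x a" using hat_obj_cases[OF \<xi>] .
  obtain n y b where y: "y \<in> inj_maps n Y" "b \<in> A n"
    "hat_map A Am P Y q \<omega> = hat_class A Am Y n y b" using hat_obj_cases[OF \<eta>] .
  have "hat_map A Am X Z f (hat_map A Am P X p \<omega>) \<in> hat_obj A Am Z"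
    using hat_map_in[OF f] \<xi> by blast
  then obtain k z d where z: "z \<in> inj_maps k Z" "d \<in> A k"
    "hat_map A Am X Z f (hat_map A Am P X p \<omega>) = hat_class A Am Z k z d"
    using hat_obj_cases by metis
  \<comment> \<open>Commutativity of the square lets one injection \<open>z\<close> carry both
    \<open>f \<circ> x\<close> and \<open>g \<circ> y\<close>, which the construction of the finite
    pullback requires.\<close>
  have z': "hat_map A Am Y Z g (hat_map A Am P Y q \<omega>) = hat_class A Am Z k z d"
    using hat_map_comm[OF p q f g comm \<omega>] z(3) by simp
  obtain f1 where f1: "f1 \<in> surj_maps m k" "compose {1..m} f x = compose {1..m} z f1"
    using hat_map_class_eq_iff[OF f x(1,2) z(1,2)] z(3) x(3) by metis
  obtain g1 where g1: "g1 \<in> surj_maps n k" "compose {1..n} g y = compose {1..n} z g1"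
    using hat_map_class_eq_iff[OF g y(1,2) z(1,2)] z' y(3) by metis
  obtain r v g2 f2 where R: "surj_pullback r m n k g2 f2 f1 g1" "v \<in> inj_maps r P"
    "\<forall>i\<in>{1..r}. p (v i) = x (g2 i)" "\<forall>i\<in>{1..r}. q (v i) = y (f2 i)"
    "\<And>j l. j \<in> {1..m} \<Longrightarrow> l \<in> {1..n} \<Longrightarrow> f1 j = g1 l \<Longrightarrow> \<exists>i\<in>{1..r}. g2 i = j \<and> f2 i = l"
    by (rule finite_pullback_exists[OF f g univ comm x(1) y(1) z(1) f1 g1]) (rule that)
  \<comment> \<open>The surjections \<alpha> and \<beta> relating \<open>u\<close> to
    \<open>x\<close> and \<open>y\<close> satisfy
    \<open>f1 \<circ> \<alpha> = g1 \<circ> \<beta>\<close>, since \<open>z\<close> is injective and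
    the square commutes. So each pair \<open>(\<alpha> i, \<beta> i)\<close> comes from a point
    \<open>h i\<close> of the finite pullback.\<close>
  have factor: "\<exists>h\<in>inj_maps t {1..r}. u = compose {1..t} v h \<and>
      compose {1..t} g2 h \<in> surj_maps t m \<and> compose {1..t} f2 h \<in> surj_maps t n \<and>
      Am t m (compose {1..t} g2 h) e = a \<and> Am t n (compose {1..t} f2 h) e = b"
    if u: "u \<in> inj_maps t P" and e: "e \<in> A t"
      and uX: "hat_map A Am P X p (hat_class A Am P t u e) = hat_class A Am X m x a"
      and uY: "hat_map A Am P Y q (hat_class A Am P t u e) = hat_class A Am Y n y b" for t u e
  proof -
    obtain \<alpha> where \<alpha>: "\<alpha> \<in> surj_maps t m" "\<forall>i\<in>{1..t}. p (u i) = x (\<alpha> i)" "Am t m \<alpha> e = a"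
      using hat_map_class_eq_iff[OF p u e x(1,2)] uX unfolding compose_eq_compose_iff by blast
    obtain \<beta> where \<beta>: "\<beta> \<in> surj_maps t n" "\<forall>i\<in>{1..t}. q (u i) = y (\<beta> i)" "Am t n \<beta> e = b"
      using hat_map_class_eq_iff[OF q u e y(1,2)] uY unfolding compose_eq_compose_iff by blast
    have "\<exists>l\<in>{1..r}. g2 l = \<alpha> i \<and> f2 l = \<beta> i" if i: "i \<in> {1..t}" for i
    proof -
      have ab: "\<alpha> i \<in> {1..m}" "\<beta> i \<in> {1..n}" using surj_maps_mem \<alpha>(1) \<beta>(1) i by blast+
      have "z (f1 (\<alpha> i)) = f (p (u i))"
        using f1(2) \<alpha>(2) ab i unfolding compose_eq_compose_iff by simp
      also have "\<dots> = g (q (u i))" using comm inj_maps_mem[OF u i] by blast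
      also have "\<dots> = z (g1 (\<beta> i))"
        using g1(2) \<beta>(2) ab i unfolding compose_eq_compose_iff by simp
      finally have "f1 (\<alpha> i) = g1 (\<beta> i)"
        using inj_maps_eqD[OF z(1)] surj_maps_mem[OF f1(1) ab(1)] surj_maps_mem[OF g1(1) ab(2)]
        by blast
      then show ?thesis using R(5) ab by blast
    qed
    then obtain h0 where h0: "\<And>i. i \<in> {1..t} \<Longrightarrow> h0 i \<in> {1..r} \<and> g2 (h0 i) = \<alpha> i \<and> f2 (h0 i) = \<beta> i"
      by metis
    define h where "h = restrict h0 {1..t}"
    have h: "h i \<in> {1..r}" "g2 (h i) = \<alpha> i" "f2 (h i) = \<beta> i" if "i \<in> {1..t}" for i
      using h0[OF that] that by (simp_all add: h_def)
    \<comment> \<open>The two points of \<open>P\<close> have the same projections to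
      \<open>X\<close> and \<open>Y\<close>, so they coincide by universality.\<close>
    have vh: "v (h i) = u i" if i: "i \<in> {1..t}" for i
    proof -
      have e: "p (v (h i)) = p (u i)" "q (v (h i)) = q (u i)"
        using R(3,4) h[OF i] \<alpha>(2) \<beta>(2) i by simp_all
      have P: "v (h i) \<in> P" "u i \<in> P" using inj_maps_mem R(2) u h(1) i by blast+
      then have "p (u i) \<in> X" "q (u i) \<in> Y" "f (p (u i)) = g (q (u i))" using p q comm by blast+
      then show ?thesis using univ P e by blast
    qed
    have "inj_on h {1..t}"
      using vh inj_maps_eqD[OF u] by (intro inj_onI) metis
    then have hi: "h \<in> inj_maps t {1..r}" using h(1) by (auto simp: inj_maps_def h_def)
    have "\<alpha> \<in> {1..t} \<rightarrow>\<^sub>E {1..m}" "\<beta> \<in> {1..t} \<rightarrow>\<^sub>E {1..n}" "u \<in> {1..t} \<rightarrow>\<^sub>E P"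
      using \<alpha>(1) \<beta>(1) u by (simp_all add: surj_maps_def inj_maps_def)
    note ext = this[THEN compose_eq_iff]
    have "compose {1..t} g2 h = \<alpha>" "compose {1..t} f2 h = \<beta>" "compose {1..t} v h = u"
      unfolding ext using h(2,3) vh by blast+
    then show ?thesis using hi \<alpha>(1,3) \<beta>(1,3) by (intro bexI[of _ h]) simp_all
  qed
  obtain h where h: "h \<in> inj_maps s {1..r}" "w = compose {1..s} v h"
    "compose {1..s} g2 h \<in> surj_maps s m" "compose {1..s} f2 h \<in> surj_maps s n"
    "Am s m (compose {1..s} g2 h) c = a" "Am s n (compose {1..s} f2 h) c = b"
    using factor[OF w(1,2)] x(3) y(3) w(3) by blast
  obtain h' where h': "h' \<in> inj_maps s' {1..r}" "w' = compose {1..s'} v h'"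
    "compose {1..s'} g2 h' \<in> surj_maps s' m" "compose {1..s'} f2 h' \<in> surj_maps s' n"
    "Am s' m (compose {1..s'} g2 h') c' = a" "Am s' n (compose {1..s'} f2 h') c' = b"
    using factor[OF w'(1,2)] x(3) y(3) w'(3) eqX eqY by auto
  have "s = s' \<and> (\<exists>\<sigma>\<in>sym_maps s. compose {1..s} h' \<sigma> = h \<and> Am s s \<sigma> c = c')"
    using PB[unfolded PB_def, rule_format, OF R(1) h(1) h'(1) w(2) w'(2) h(4) h'(4) h(3) h'(3)]
    unfolding h(5,6) h'(5,6) by blast
  then obtain \<sigma> where s: "s' = s" "\<sigma> \<in> sym_maps s" "compose {1..s} h' \<sigma> = h" "Am s s \<sigma> c = c'"
    by blast
  \<comment> \<open>Composing \<open>h = h' \<circ> \<sigma>\<close> with \<open>v\<close> on the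
    left.\<close>
  have "w = compose {1..s} w' \<sigma>"
    unfolding h(2) h'(2) s(1) compose_eq_compose_iff s(3)[symmetric]
    using surj_maps_mem[OF sym_maps_surj[OF s(2)]] by (simp add: compose_eq)
  then show ?thesis
    unfolding w(3) w'(3) using hat_class_eq_iff[OF w(1,2) w'(1,2)] s by blast
qed

text \<open>Both squares are tested on elements: \<open>hat_lift_exists\<close> and
  \<open>hat_lift_unique\<close> give the unique lift of a compatible pair, and
  \<open>hat_map_comm\<close> gives commutativity of the image square.\<close>

lemma preserves_pullbacks_if_WPB_PB:
  assumes "WPB A Am" and "PB A Am"
  shows "preserves_pullbacks (hat_obj A Am :: 'u set \<Rightarrow> _) (hat_map A Am)"
  unfolding preserves_pullbacks_def
proof (intro allI impI)
  fix P X Y Z :: "'u set" and p q f g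
  assume "is_pullback (UNIV :: 'u set set) P X Y Z p q f g"
  then have pb: "p \<in> P \<rightarrow>\<^sub>E X" "q \<in> P \<rightarrow>\<^sub>E Y" "f \<in> X \<rightarrow>\<^sub>E Z" "g \<in> Y \<rightarrow>\<^sub>E Z"
     "\<forall>w\<in>P. f (p w) = g (q w)"
     "\<forall>x\<in>X. \<forall>y\<in>Y. f x = g y \<longrightarrow> (\<exists>!w. w \<in> P \<and> p w = x \<and> q w = y)"
    unfolding is_pullback_iff[OF UNIV_I] by simp_all
  show "is_pullback (UNIV :: (nat \<times> ((nat \<Rightarrow> 'u) \<times> 'a) set) set set)
    (hat_obj A Am P) (hat_obj A Am X) (hat_obj A Am Y) (hat_obj A Am Z)
    (hat_map A Am P X p) (hat_map A Am P Y q) (hat_map A Am X Z f) (hat_map A Am Y Z g)"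
    unfolding is_pullback_iff[OF UNIV_I]
  proof (intro conjI ballI impI)
    fix \<xi> \<eta> assume H: "\<xi> \<in> hat_obj A Am X" "\<eta> \<in> hat_obj A Am Y"
      "hat_map A Am X Z f \<xi> = hat_map A Am Y Z g \<eta>"
    obtain \<omega> where \<omega>: "\<omega> \<in> hat_obj A Am P" "hat_map A Am P X p \<omega> = \<xi>" "hat_map A Am P Y q \<omega> = \<eta>"
      using hat_lift_exists[OF assms(1) pb H] by blast
    show "\<exists>!\<omega>. \<omega> \<in> hat_obj A Am P \<and> hat_map A Am P X p \<omega> = \<xi> \<and> hat_map A Am P Y q \<omega> = \<eta>"
    proof (rule ex1I[of _ \<omega>])
      fix \<omega>' assume *: "\<omega>' \<in> hat_obj A Am P \<and> hat_map A Am P X p \<omega>' = \<xi> \<and> hat_map A Am P Y q \<omega>' = \<eta>"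
      show "\<omega>' = \<omega>"
        by (rule hat_lift_unique[OF assms(2) pb]) (simp_all only: * \<omega>)
    qed (simp only: \<omega>)
  qed (rule hat_map_in pb(1-4) hat_map_comm[OF pb(1-5)], assumption?)+
qed

end

section \<open>Transport of finite squares along an injection of the natural numbers\<close>

text \<open>The conjugate of \<alpha> by \<open>e\<close>, restricted to the image of
  \<open>{1..n}\<close> so that it is extensional. Inverting the whole of \<open>e\<close>, and not
  its restrictions, lets one injection serve all corners of a square.\<close>

definition transport :: "(nat \<Rightarrow> 'u) \<Rightarrow> nat \<Rightarrow> (nat \<Rightarrow> nat) \<Rightarrow> 'u \<Rightarrow> 'u" where
  "transport e n \<alpha> = (\<lambda>u\<in>e ` {1..n}. e (\<alpha> (inv e u)))"

lemma transport_apply: "inj e \<Longrightarrow> i \<in> {1..n} \<Longrightarrow> transport e n \<alpha> (e i) = e (\<alpha> i)"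
  by (simp add: transport_def)

lemma transport_mem:
  assumes "inj e" and "\<alpha> \<in> surj_maps n m"
  shows "transport e n \<alpha> \<in> e ` {1..n} \<rightarrow>\<^sub>E e ` {1..m}"
proof (rule PiE_I)
  fix u assume "u \<in> e ` {1..n}"
  then obtain i where i: "u = e i" "i \<in> {1..n}" by blast
  then show "transport e n \<alpha> u \<in> e ` {1..m}"
    unfolding i(1) transport_apply[OF assms(1) i(2)] using surj_maps_mem[OF assms(2)] by blast
qed (simp add: transport_def)

text \<open>On every corner \<open>e\<close> is a bijection onto its image that intertwines the maps
  of the two squares, so unique preimages of compatible pairs correspond.\<close>

lemma is_pullback_transport:
  fixes e :: "nat \<Rightarrow> 'u"
  assumes e: "inj e" and pb: "surj_pullback r m n k g2 f2 f1 g1"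
  shows "is_pullback (UNIV :: 'u set set) (e ` {1..r}) (e ` {1..m}) (e ` {1..n}) (e ` {1..k})
    (transport e r g2) (transport e r f2) (transport e m f1) (transport e n g1)"
proof -
  note pb = pb[unfolded surj_pullback_iff]
  have g2: "g2 \<in> surj_maps r m" and f2: "f2 \<in> surj_maps r n"
    and f1: "f1 \<in> surj_maps m k" and g1: "g1 \<in> surj_maps n k" using pb by blast+
  show ?thesis
    unfolding is_pullback_iff[OF UNIV_I]
  proof (intro conjI ballI impI)
    fix w assume "w \<in> e ` {1..r}"
    then obtain i where i: "w = e i" "i \<in> {1..r}" by blast
    have "g2 i \<in> {1..m}" "f2 i \<in> {1..n}" using surj_maps_mem g2 f2 i(2) by blast+
    then show "transport e m f1 (transport e r g2 w) = transport e n g1 (transport e r f2 w)"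
      using pb i(2) by (simp add: i(1) transport_apply[OF e] del: atLeastAtMost_iff)
  next
    fix x y assume "x \<in> e ` {1..m}" "y \<in> e ` {1..n}"
      and eq: "transport e m f1 x = transport e n g1 y"
    then obtain i j where ij: "x = e i" "y = e j" "i \<in> {1..m}" "j \<in> {1..n}" by blast
    then have "f1 i = g1 j"
      using eq e by (simp add: transport_apply[OF e] inj_eq del: atLeastAtMost_iff)
    then have "\<exists>!w. w \<in> {1..r} \<and> g2 w = i \<and> f2 w = j" using pb ij by blast
    then obtain l where l: "l \<in> {1..r}" "g2 l = i" "f2 l = j"
      and un: "\<And>l'. l' \<in> {1..r} \<Longrightarrow> g2 l' = i \<Longrightarrow> f2 l' = j \<Longrightarrow> l' = l" by blast
    show "\<exists>!w. w \<in> e ` {1..r} \<and> transport e r g2 w = x \<and> transport e r f2 w = y"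
    proof (rule ex1I[of _ "e l"])
      show "e l \<in> e ` {1..r} \<and> transport e r g2 (e l) = x \<and> transport e r f2 (e l) = y"
        using l ij by (simp add: transport_apply[OF e] del: atLeastAtMost_iff)
    next
      fix w assume w: "w \<in> e ` {1..r} \<and> transport e r g2 w = x \<and> transport e r f2 w = y"
      then obtain l' where l': "w = e l'" "l' \<in> {1..r}" by blast
      then have "g2 l' = i" "f2 l' = j"
        using w ij e by (simp_all add: transport_apply[OF e] inj_eq del: atLeastAtMost_iff)
      then show "w = e l" using un l' by blast
    qed
  qed (use transport_mem[OF e] g2 f2 f1 g1 in blast)+
qed

lemma restrict_inj_maps: "inj e \<Longrightarrow> restrict e {1..n} \<in> inj_maps n (e ` {1..n})"
  by (auto simp: inj_maps_def inj_on_def)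

section \<open>Necessity of (WPB) and (PB)\<close>

context S_functor
begin

text \<open>The conjugate of \<alpha> sends \<open>e \<circ> h\<close> to
  \<open>e \<circ> (\<alpha> \<circ> h)\<close>. Since \<open>e\<close> can be cancelled, the
  surjection witnessing the left side must be \<open>\<alpha> \<circ> h\<close> itself. The right
  side is exactly the form of the conditions in (WPB) and (PB).\<close>

lemma hat_map_transport:
  fixes e :: "nat \<Rightarrow> 'u"
  assumes e: "inj e" and al: "\<alpha> \<in> surj_maps r m"
    and h: "h \<in> inj_maps q {1..r}" and c: "c \<in> A q" and a: "a \<in> A m"
  shows "hat_map A Am (e ` {1..r}) (e ` {1..m}) (transport e r \<alpha>)
      (hat_class A Am (e ` {1..r}) q (compose {1..q} e h) c)
      = hat_class A Am (e ` {1..m}) m (restrict e {1..m}) a \<longleftrightarrow>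
    compose {1..q} \<alpha> h \<in> surj_maps q m \<and> Am q m (compose {1..q} \<alpha> h) c = a" (is "?L \<longleftrightarrow> ?R")
proof -
  have "compose {1..q} e h = compose {1..q} (restrict e {1..r}) h"
    unfolding compose_eq_compose_iff using inj_maps_mem[OF h] by simp
  then have eh: "compose {1..q} e h \<in> inj_maps q (e ` {1..r})"
    using inj_maps_compose[OF restrict_inj_maps[OF e] h] by simp
  have "?L \<longleftrightarrow> (\<exists>\<beta>\<in>surj_maps q m. compose {1..q} (transport e r \<alpha>) (compose {1..q} e h) =
      compose {1..q} (restrict e {1..m}) \<beta> \<and> Am q m \<beta> c = a)"
    by (rule hat_map_class_eq_iff[OF transport_mem[OF e al] eh c restrict_inj_maps[OF e] a])
  also have "\<dots> \<longleftrightarrow> (\<exists>\<beta>\<in>surj_maps q m. compose {1..q} \<alpha> h = \<beta> \<and> Am q m \<beta> c = a)"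
  proof (intro bex_cong refl conj_cong)
    fix \<beta> assume b: "\<beta> \<in> surj_maps q m"
    have "compose {1..q} (transport e r \<alpha>) (compose {1..q} e h) =
        compose {1..q} (restrict e {1..m}) \<beta> \<longleftrightarrow> (\<forall>i\<in>{1..q}. \<alpha> (h i) = \<beta> i)"
      unfolding compose_eq_compose_iff
      using inj_maps_mem[OF h] surj_maps_mem[OF b] e
      by (simp add: compose_eq transport_apply[OF e] inj_eq del: atLeastAtMost_iff)
    also have "\<dots> \<longleftrightarrow> compose {1..q} \<alpha> h = \<beta>"
    proof -
      have "\<beta> \<in> {1..q} \<rightarrow>\<^sub>E {1..m}" using b by (simp add: surj_maps_def)
      from compose_eq_iff[OF this, symmetric] show ?thesis .
    qed
    finally show "compose {1..q} (transport e r \<alpha>) (compose {1..q} e h) =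
        compose {1..q} (restrict e {1..m}) \<beta> \<longleftrightarrow> compose {1..q} \<alpha> h = \<beta>" .
  qed
  also have "\<dots> \<longleftrightarrow> ?R" by blast
  finally show ?thesis .
qed

text \<open>An injection into the image of \<open>e\<close> is pulled back along \<open>e\<close> to
  an injection of finite sets, which provides the \<open>h\<close> sought in (WPB).\<close>

lemma hat_obj_image_cases:
  fixes e :: "nat \<Rightarrow> 'u"
  assumes e: "inj e" and \<omega>: "\<omega> \<in> hat_obj A Am (e ` {1..r})"
  obtains q h c where "h \<in> inj_maps q {1..r}" "c \<in> A q"
    "\<omega> = hat_class A Am (e ` {1..r}) q (compose {1..q} e h) c"
proof -
  obtain q w c where w: "w \<in> inj_maps q (e ` {1..r})" "c \<in> A q"
    "\<omega> = hat_class A Am (e ` {1..r}) q w c" using hat_obj_cases[OF \<omega>] .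
  define h where "h = (\<lambda>i\<in>{1..q}. inv e (w i))"
  have h: "h i \<in> {1..r}" "e (h i) = w i" if i: "i \<in> {1..q}" for i
  proof -
    obtain j where j: "w i = e j" "j \<in> {1..r}" using inj_maps_mem[OF w(1) i] by blast
    then have "h i = j" unfolding h_def restrict_apply'[OF i] using e by simp
    then show "h i \<in> {1..r}" "e (h i) = w i" using j by simp_all
  qed
  have "inj_on h {1..q}" using h(2) inj_maps_eqD[OF w(1)] by (intro inj_onI) metis
  then have hi: "h \<in> inj_maps q {1..r}" using h(1) by (auto simp: inj_maps_def h_def)
  have "w \<in> {1..q} \<rightarrow>\<^sub>E e ` {1..r}" using w(1) by (simp add: inj_maps_def)
  then have "compose {1..q} e h = w" using h(2) compose_eq_iff by blast
  then show ?thesis using that hi w by blast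
qed

text \<open>The conjugate of \<alpha> after \<open>e\<close> is \<open>e \<circ> \<alpha>\<close>,
  already factored as a surjection followed by an injection, so \<open>[e, a]\<close> is sent to
  \<open>[e, A(\<alpha>)(a)]\<close>.\<close>

lemma hat_map_transport_eq:
  fixes e :: "nat \<Rightarrow> 'u"
  assumes e: "inj e" and f1: "f1 \<in> surj_maps m k" and g1: "g1 \<in> surj_maps n k"
    and a: "a \<in> A m" and b: "b \<in> A n" and eq: "Am m k f1 a = Am n k g1 b"
  shows "hat_map A Am (e ` {1..m}) (e ` {1..k}) (transport e m f1)
      (hat_class A Am (e ` {1..m}) m (restrict e {1..m}) a) =
    hat_map A Am (e ` {1..n}) (e ` {1..k}) (transport e n g1)
      (hat_class A Am (e ` {1..n}) n (restrict e {1..n}) b)"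
proof -
  have *: "hat_map A Am (e ` {1..l}) (e ` {1..k}) (transport e l \<alpha>)
      (hat_class A Am (e ` {1..l}) l (restrict e {1..l}) c) =
    hat_class A Am (e ` {1..k}) k (restrict e {1..k}) (Am l k \<alpha> c)"
    if "\<alpha> \<in> surj_maps l k" "c \<in> A l" for l \<alpha> c
  proof -
    have "compose {1..l} (transport e l \<alpha>) (restrict e {1..l}) = compose {1..l} (restrict e {1..k}) \<alpha>"
      unfolding compose_eq_compose_iff using surj_maps_mem[OF that(1)]
      by (simp add: transport_apply[OF e] del: atLeastAtMost_iff)
    then show ?thesis
      using hat_map_class[OF transport_mem[OF e that(1)] restrict_inj_maps[OF e] that(2) that(1)
          restrict_inj_maps[OF e]] by blast
  qed
  show ?thesis using *[OF f1 a] *[OF g1 b] eq by simp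
qed

text \<open>A transported finite square stays a pullback after applying the hat functor, so
  \<open>[e, a]\<close> and \<open>[e, b]\<close> have a unique common lift whenever
  \<open>A(f1)(a) = A(g1)(b)\<close>. Existence of the lift is (WPB); its uniqueness gives
  (PB).\<close>

lemma WPB_PB_if_preserves_pullbacks:
  assumes inf: "infinite (UNIV :: 'u set)"
    and pres: "preserves_pullbacks (hat_obj A Am :: 'u set \<Rightarrow> _) (hat_map A Am)"
  shows "WPB A Am" and "PB A Am"
proof -
  obtain e :: "nat \<Rightarrow> 'u" where e: "inj e" using inf infinite_countable_subset by blast
  have hat: "is_pullback (UNIV :: (nat \<times> ((nat \<Rightarrow> 'u) \<times> 'a) set) set set) (hat_obj A Am (e ` {1..r})) (hat_obj A Am (e ` {1..m}))
      (hat_obj A Am (e ` {1..n})) (hat_obj A Am (e ` {1..k}))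
      (hat_map A Am (e ` {1..r}) (e ` {1..m}) (transport e r g2))
      (hat_map A Am (e ` {1..r}) (e ` {1..n}) (transport e r f2))
      (hat_map A Am (e ` {1..m}) (e ` {1..k}) (transport e m f1))
      (hat_map A Am (e ` {1..n}) (e ` {1..k}) (transport e n g1))"
    if "surj_pullback r m n k g2 f2 f1 g1" for r m n k g2 f2 f1 g1
    by (rule pres[unfolded preserves_pullbacks_def, rule_format, OF is_pullback_transport[OF e that]])
  have univ: "\<exists>!\<omega>. \<omega> \<in> hat_obj A Am (e ` {1..r}) \<and>
      hat_map A Am (e ` {1..r}) (e ` {1..m}) (transport e r g2) \<omega> =
        hat_class A Am (e ` {1..m}) m (restrict e {1..m}) a \<and>
      hat_map A Am (e ` {1..r}) (e ` {1..n}) (transport e r f2) \<omega> =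
        hat_class A Am (e ` {1..n}) n (restrict e {1..n}) b"
    if pb: "surj_pullback r m n k g2 f2 f1 g1" and ab: "a \<in> A m" "b \<in> A n"
      and eq: "Am m k f1 a = Am n k g1 b" for r m n k g2 f2 f1 g1 a b
  proof -
    have fg: "f1 \<in> surj_maps m k" "g1 \<in> surj_maps n k" using pb by (simp_all add: surj_pullback_def)
    show ?thesis
      using hat[OF pb] hat_map_transport_eq[OF e fg ab eq]
        hat_class_mem[OF restrict_inj_maps[OF e] ab(1)]
        hat_class_mem[OF restrict_inj_maps[OF e] ab(2)]
      unfolding is_pullback_iff[OF UNIV_I] by blast
  qed
  show "WPB A Am"
    unfolding WPB_def
  proof (intro allI impI ballI)
    fix r m n k g2 f2 f1 g1 a b
    assume pb: "surj_pullback r m n k g2 f2 f1 g1"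
      and ab: "a \<in> A m" "b \<in> A n" "Am m k f1 a = Am n k g1 b"
    have g2: "g2 \<in> surj_maps r m" and f2: "f2 \<in> surj_maps r n"
      using pb by (simp_all add: surj_pullback_def)
    obtain \<omega> where \<omega>: "\<omega> \<in> hat_obj A Am (e ` {1..r})"
      "hat_map A Am (e ` {1..r}) (e ` {1..m}) (transport e r g2) \<omega> =
        hat_class A Am (e ` {1..m}) m (restrict e {1..m}) a"
      "hat_map A Am (e ` {1..r}) (e ` {1..n}) (transport e r f2) \<omega> =
        hat_class A Am (e ` {1..n}) n (restrict e {1..n}) b"
      using univ[OF pb ab] by blast
    obtain q h c where h: "h \<in> inj_maps q {1..r}" "c \<in> A q"
      "\<omega> = hat_class A Am (e ` {1..r}) q (compose {1..q} e h) c"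
      using hat_obj_image_cases[OF e \<omega>(1)] .
    show "\<exists>q. \<exists>h\<in>inj_maps q {1..r}. \<exists>c\<in>A q.
           compose {1..q} f2 h \<in> surj_maps q n \<and> compose {1..q} g2 h \<in> surj_maps q m \<and>
           Am q m (compose {1..q} g2 h) c = a \<and> Am q n (compose {1..q} f2 h) c = b"
      using hat_map_transport[OF e g2 h(1,2) ab(1)] hat_map_transport[OF e f2 h(1,2) ab(2)]
        \<omega>(2,3) h by blast
  qed
  show "PB A Am"
    unfolding PB_def
  proof (intro allI impI ballI)
    fix r m n k g2 f2 f1 g1 q q' x x' c c'
    assume pb: "surj_pullback r m n k g2 f2 f1 g1"
      and x: "x \<in> inj_maps q {1..r}" and x': "x' \<in> inj_maps q' {1..r}"
      and c: "c \<in> A q" and c': "c' \<in> A q'"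
      and f2x: "compose {1..q} f2 x \<in> surj_maps q n"
      and f2x': "compose {1..q'} f2 x' \<in> surj_maps q' n"
      and g2x: "compose {1..q} g2 x \<in> surj_maps q m"
      and g2x': "compose {1..q'} g2 x' \<in> surj_maps q' m"
      and eqf: "Am q n (compose {1..q} f2 x) c = Am q' n (compose {1..q'} f2 x') c'"
      and eqg: "Am q m (compose {1..q} g2 x) c = Am q' m (compose {1..q'} g2 x') c'"
    note pbD = pb[unfolded surj_pullback_iff]
    have g2: "g2 \<in> surj_maps r m" and f2: "f2 \<in> surj_maps r n"
      and f1: "f1 \<in> surj_maps m k" and g1: "g1 \<in> surj_maps n k" using pbD by blast+
    \<comment> \<open>By \<open>eqg\<close> and \<open>eqf\<close> these are also the images of
      \<open>c'\<close>, so both candidates lie over one pair, whose compatibility follows from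
      commutativity of the finite square.\<close>
    let ?a = "Am q m (compose {1..q} g2 x) c" and ?b = "Am q n (compose {1..q} f2 x) c"
    have ab: "?a \<in> A m" "?b \<in> A n" using Am_mem g2x f2x c by blast+
    have "compose {1..q} f1 (compose {1..q} g2 x) = compose {1..q} g1 (compose {1..q} f2 x)"
      unfolding compose_eq_compose_iff using pbD inj_maps_mem[OF x]
      by (simp add: compose_eq del: atLeastAtMost_iff)
    then have eq: "Am m k f1 ?a = Am n k g1 ?b"
      using Am_compose[OF g2x f1 c] Am_compose[OF f2x g1 c] by simp
    have ex: "compose {1..l} e u = compose {1..l} (restrict e {1..r}) u"
      "compose {1..l} e u \<in> inj_maps l (e ` {1..r})" if "u \<in> inj_maps l {1..r}" for l u
    proof -
      show *: "compose {1..l} e u = compose {1..l} (restrict e {1..r}) u"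
        unfolding compose_eq_compose_iff using inj_maps_mem[OF that] by simp
      show "compose {1..l} e u \<in> inj_maps l (e ` {1..r})"
        unfolding * using inj_maps_compose[OF restrict_inj_maps[OF e] that] .
    qed
    \<comment> \<open>Both classes lift the pair \<open>[e, ?a]\<close>, \<open>[e, ?b]\<close>, so
      uniqueness in \<open>univ\<close> identifies them.\<close>
    have "hat_class A Am (e ` {1..r}) q (compose {1..q} e x) c =
        hat_class A Am (e ` {1..r}) q' (compose {1..q'} e x') c'"
    proof -
      have 1: "hat_class A Am (e ` {1..r}) q (compose {1..q} e x) c \<in> hat_obj A Am (e ` {1..r})"
        "hat_class A Am (e ` {1..r}) q' (compose {1..q'} e x') c' \<in> hat_obj A Am (e ` {1..r})"
        using hat_class_mem ex(2) x x' c c' by blast+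
      show ?thesis
        using univ[OF pb ab eq] 1
          hat_map_transport[OF e g2 x c ab(1)] hat_map_transport[OF e f2 x c ab(2)]
          hat_map_transport[OF e g2 x' c' ab(1)] hat_map_transport[OF e f2 x' c' ab(2)]
          g2x f2x g2x' f2x' eqf eqg by metis
    qed
    then obtain \<sigma> where s: "q = q'" "\<sigma> \<in> sym_maps q"
      "compose {1..q} e x = compose {1..q} (compose {1..q'} e x') \<sigma>" "Am q q \<sigma> c = c'"
      using hat_class_eq_iff[OF ex(2)[OF x] c ex(2)[OF x'] c'] by blast
    \<comment> \<open>Equality of classes relates \<open>e \<circ> x\<close> and
      \<open>e \<circ> x'\<close> by \<sigma>; cancelling \<open>e\<close> gives the relation
      between \<open>x\<close> and \<open>x'\<close>.\<close>
    have x'x: "x' (\<sigma> i) = x i" if "i \<in> {1..q}" for i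
    proof -
      have "e (x i) = e (x' (\<sigma> i))"
        using s(3) that surj_maps_mem[OF sym_maps_surj[OF s(2)] that] s(1)
        unfolding compose_eq_compose_iff by (simp add: compose_eq del: atLeastAtMost_iff)
      then show ?thesis using e by (simp add: inj_eq)
    qed
    have "x \<in> {1..q} \<rightarrow>\<^sub>E {1..r}" using x by (simp only: inj_maps_def mem_Collect_eq)
    then have "compose {1..q} x' \<sigma> = x" using x'x compose_eq_iff by blast
    then show "q = q' \<and> (\<exists>\<sigma>\<in>sym_maps q. compose {1..q} x' \<sigma> = x \<and> Am q q \<sigma> c = c')"
      using s by blast
  qed
qed

end

theorem proposition7p4:
  fixes A :: "nat \<Rightarrow> 'a set"
    and Am :: "nat \<Rightarrow> nat \<Rightarrow> (nat \<Rightarrow> nat) \<Rightarrow> 'a \<Rightarrow> 'a"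
  assumes "S_functor A Am"
    and "infinite (UNIV :: 'u set)"
  shows "preserves_pullbacks (hat_obj A Am :: 'u set \<Rightarrow> _) (hat_map A Am) \<longleftrightarrow> WPB A Am \<and> PB A Am"
proof -
  interpret S_functor A Am by fact
  show ?thesis
  proof (intro iffI conjI)
    assume "WPB A Am \<and> PB A Am"
    then show "preserves_pullbacks (hat_obj A Am :: 'u set \<Rightarrow> _) (hat_map A Am)"
      using preserves_pullbacks_if_WPB_PB by (elim conjE)
  qed (rule WPB_PB_if_preserves_pullbacks[OF assms(2)], assumption)+
qed

end
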